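(* Let $\tau\in\mathbb{C}$ with $\mathrm{Im}(\tau)>0$ and $q=e^{2i\pi\tau}$ (with $q^{s}=e^{2i\pi\tau s}$). Then, as meromorphic functions of $z\in\mathbb{C}$, $$ND(z,\tau)=\prod_{n=0}^{+\infty}(1-q^{2n+1})^2(1-q^{n+1})^2\prod_{n=0}^{+\infty}\frac{\left(1-e^{2i\pi z}q^{n+1/2}\right)\left(1-e^{-2i\pi z}q^{n+1/2}\right)}{\left(1+e^{2i\pi z}q^{n+1/2}\right)\left(1+e^{-2i\pi z}q^{n+1/2}\right)}.$$
   Context: The function $z\mapsto ND(z,\tau)$ is the meromorphic function on $\mathbb{C}$ (the renormalized Jacobi function $\mathrm{nd}$) which for $z=x+y\tau$ ($x,y\in\mathbb{R}$) is given by $$ND(z,\tau)=1+2\sum_{n=1}^{+\infty}\frac{(-1)^n\cos(2n\pi z)}{\cos(n\pi\tau)}\ \text{ when }|y|<\tfrac12,\qquad ND(z,\tau)=\frac{2}{\tau}\sum_{n=0}^{+\infty}\frac{(-1)^n\cos((2n+1)\pi z/\tau)}{\sin((n+\frac12)\pi/\tau)}\ \text{ when }|x|<\tfrac12 .$$ *)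

theory Defs
  imports "HOL-Complex_Analysis.Complex_Analysis"
begin

definition qpow :: "complex \<Rightarrow> real \<Rightarrow> complex" where
  "qpow \<tau> s = exp (2 * \<i> * of_real pi * \<tau> * of_real s)"

definition ND_strip1 :: "complex \<Rightarrow> complex \<Rightarrow> complex" where
  "ND_strip1 z \<tau> =
     1 + 2 * (\<Sum>n. (-1) ^ Suc n * cos (2 * of_nat (Suc n) * of_real pi * z)
                    / cos (of_nat (Suc n) * of_real pi * \<tau>))"

definition ND_strip2 :: "complex \<Rightarrow> complex \<Rightarrow> complex" where
  "ND_strip2 z \<tau> =
     2 / \<tau> * (\<Sum>n. (-1) ^ n * cos ((2 * of_nat n + 1) * of_real pi * z / \<tau>)
                    / sin ((of_nat n + 1 / 2) * of_real pi / \<tau>))"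

definition is_ND :: "complex \<Rightarrow> (complex \<Rightarrow> complex) \<Rightarrow> bool" where
  "is_ND \<tau> f \<longleftrightarrow>
     f nicely_meromorphic_on UNIV \<and>
     (\<forall>x y :: real. \<bar>y\<bar> < 1 / 2 \<longrightarrow>
        f (of_real x + of_real y * \<tau>) = ND_strip1 (of_real x + of_real y * \<tau>) \<tau>) \<and>
     (\<forall>x y :: real. \<bar>x\<bar> < 1 / 2 \<longrightarrow>
        f (of_real x + of_real y * \<tau>) = ND_strip2 (of_real x + of_real y * \<tau>) \<tau>)"

(* A meromorphic function on the plane is represented by its unique representative in the sense
   of nicely_meromorphic_on: the value is 0 at poles, and all removable singularities are
   removed. This makes the definite description unambiguous for Im \<tau> > 0,
   and it agrees at the poles with a product one of whose factors is x / 0 = 0. *)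
definition ND :: "complex \<Rightarrow> complex \<Rightarrow> complex" where
  "ND z \<tau> = (THE f. is_ND \<tau> f) z"

end

(* Put u = exp (2 pi i z + pi i tau) and v = exp (-2 pi i z + pi i tau), so that u v = q. The product
   is F = C E(-u) E(-v) / (E(u) E(v)) with E(x) = prod (1 + x q^k). Expanding the denominators
   1 + q^n and 1 - r^(2n+1), r = exp (-pi i / tau), turns the two trigonometric series of ND into
   Lambert-type series S and T, which make sense at every z outside the coset
   P = 1/2 + tau/2 + Z + Z tau. Each of F, S and T is invariant under z -> z + 1, changes sign under
   z -> z + tau, and has only simple poles, at P, with residue i/pi at 1/2 - tau/2; for F the residue
   is computed with Euler's identity prod (1 + q^n) (1 - q^(2n-1)) = 1. The differences F - S and
   F - T therefore extend to bounded entire functions, which are constant by Liouville's theorem and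
   vanish because they change sign. *)
theory Submission
  imports Defs
begin

subsection \<open>Antiperiodic functions with at most one pole modulo the lattice\<close>

text \<open>Each trigonometric series converges only in its own strip, so \<open>S\<close> and
  \<open>T\<close> are never compared with each other there: each is compared with the globally
  defined \<open>F\<close>. Matching poles and residues alone would leave an unknown constant, whose
  determination needs a special value that is itself a nontrivial identity; the sign change under
  \<tau> removes it for free. Passing from a trigonometric series to its Lambert form looks like an
  interchange in a double sum. This is replaced by uniqueness: on the unit disc both sides solve g x
  = t x + s * g (q * x), are continuous at 0 and vanish there. The second series belongs to the
  modular partner -1/\<tau>, so the periods 1 and \<tau> exchange roles: what is a functional
  equation for one series is a mere symmetry for the other. As \<open>ND\<close> is a definite
  description, \<open>F\<close> must moreover have the prescribed value 0 at its poles, and an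
  identity theorem must give uniqueness.\<close>

lemma lattice_coset_separated:
  fixes \<tau> w :: complex
  assumes "Im \<tau> > 0"
    and "x \<in> {w + of_int m + of_int n * \<tau> | m n. True}"
    and "y \<in> {w + of_int m + of_int n * \<tau> | m n. True}"
    and "dist y x < min 1 (Im \<tau>)"
  shows "y = x"
proof -
  obtain m n m' n' where x: "x = w + of_int m + of_int n * \<tau>" and y: "y = w + of_int m' + of_int n' * \<tau>"
    using assms(2,3) by blast
  have d: "y - x = of_int (m' - m) + of_int (n' - n) * \<tau>"
    by (simp add: x y algebra_simps)
  have "\<bar>Im (y - x)\<bar> < Im \<tau>"
    using abs_Im_le_cmod[of "y - x"] assms(4) by (simp add: dist_norm)
  hence "\<bar>real_of_int (n' - n)\<bar> * Im \<tau> < 1 * Im \<tau>"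
    using assms(1) by (simp add: d abs_mult del: of_int_diff)
  hence "\<bar>real_of_int (n' - n)\<bar> < 1"
    using assms(1) mult_less_cancel_right_pos by blast
  hence n: "n' - n = 0"
    by linarith
  have "norm (of_int (m' - m) :: complex) < 1"
    using assms(4) unfolding dist_norm d n by simp
  hence "m' - m = 0"
    unfolding norm_of_int by linarith
  thus ?thesis
    using n by (simp add: x y)
qed

text \<open>The functional equations are available only off \<open>P\<close>, so both inductions
  also carry the fact that the translated point stays off \<open>P\<close>. Negative steps solve the
  equation at the lower point backwards.\<close>

lemma antiperiodic_shift:
  fixes h :: "complex \<Rightarrow> 'a :: comm_ring_1"
  assumes P: "\<And>z. z + 1 \<in> P \<longleftrightarrow> z \<in> P" "\<And>z. z + \<tau> \<in> P \<longleftrightarrow> z \<in> P"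
    and per: "\<And>z. z \<notin> P \<Longrightarrow> h (z + 1) = h z" "\<And>z. z \<notin> P \<Longrightarrow> h (z + \<tau>) = - h z"
    and z: "z \<notin> P"
  shows "h (z + of_int m + of_int n * \<tau>) = (if even n then 1 else -1) * h z"
proof -
  have 1: "h (z + of_int m) = h z \<and> z + of_int m \<notin> P"
  proof (induction m rule: int_induct[of _ 0])
    case base
    show ?case using z by simp
  next
    case (step1 i)
    have "z + of_int (i + 1) = (z + of_int i) + 1" by simp
    thus ?case using step1 P per by metis
  next
    case (step2 i)
    have *: "z + of_int i = (z + of_int (i - 1)) + 1" by simp
    have "z + of_int (i - 1) \<notin> P"
      using step2 P unfolding * by blast
    thus ?case using step2 per(1) unfolding * by metis
  qed
  have "h (z + of_int m + of_int n * \<tau>) = (if even n then 1 else -1) * h z \<and>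
        z + of_int m + of_int n * \<tau> \<notin> P"
  proof (induction n rule: int_induct[of _ 0])
    case base
    show ?case using 1 by simp
  next
    case (step1 i)
    have *: "z + of_int m + of_int (i + 1) * \<tau> = (z + of_int m + of_int i * \<tau>) + \<tau>"
      by (simp add: algebra_simps)
    show ?case using step1 P(2) per(2) unfolding * by auto
  next
    case (step2 i)
    have *: "z + of_int m + of_int i * \<tau> = (z + of_int m + of_int (i - 1) * \<tau>) + \<tau>"
      by (simp add: algebra_simps)
    have notin: "z + of_int m + of_int (i - 1) * \<tau> \<notin> P"
      using step2 P(2) unfolding * by blast
    have "h (z + of_int m + of_int i * \<tau>) = - h (z + of_int m + of_int (i - 1) * \<tau>)"
      unfolding * by (rule per(2)[OF notin])
    hence "h (z + of_int m + of_int (i - 1) * \<tau>) = - h (z + of_int m + of_int i * \<tau>)"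
      by simp
    thus ?case using step2 notin by auto
  qed
  thus ?thesis by blast
qed

text \<open>
  The limit of \<open>(z - w) * h z\<close> makes the singularity at \<open>w\<close> removable, hence by periodicity all of them;
  Liouville's theorem makes the extension constant, and antiperiodicity makes the constant \<open>0\<close>.
\<close>
lemma antiperiodic_removable_imp_zero:
  fixes \<tau> w :: complex and h :: "complex \<Rightarrow> complex"
  defines "P \<equiv> {w + of_int m + of_int n * \<tau> | m n. True}"
  assumes \<tau>: "Im \<tau> > 0"
    and hol: "h holomorphic_on - P"
    and per: "\<And>z. z \<notin> P \<Longrightarrow> h (z + 1) = h z" "\<And>z. z \<notin> P \<Longrightarrow> h (z + \<tau>) = - h z"
    and lim: "((\<lambda>z. (z - w) * h z) \<longlongrightarrow> 0) (at w)"
    and z: "z \<notin> P"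
  shows "h z = 0"
proof -
  define \<delta> where "\<delta> = min 1 (Im \<tau>)"
  have \<delta>: "\<delta> > 0" using \<tau> by (simp add: \<delta>_def)
  have sep: "y = x" if "x \<in> P" "y \<in> P" "dist y x < \<delta>" for x y
    using lattice_coset_separated[OF \<tau>] that unfolding P_def \<delta>_def by blast
  have "closed P"
    by (rule discrete_imp_closed[OF \<delta>]) (use sep in blast)
  hence opn: "open (- P)" by auto
  have shift: "z + of_int m + of_int n * \<tau> \<in> P" if zP: "z \<in> P" for z m n
  proof -
    obtain a b where "z = w + of_int a + of_int b * \<tau>" using zP unfolding P_def by blast
    hence "z + of_int m + of_int n * \<tau> = w + of_int (a + m) + of_int (b + n) * \<tau>"
      by (simp add: algebra_simps)
    thus ?thesis unfolding P_def by blast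
  qed
  have P1: "z + 1 \<in> P \<longleftrightarrow> z \<in> P" for z
    using shift[of z 1 0] shift[of "z + 1" "-1" 0] by auto
  have P2: "z + \<tau> \<in> P \<longleftrightarrow> z \<in> P" for z
    using shift[of z 0 1] shift[of "z + \<tau>" 0 "-1"] by auto
  note h_shift = antiperiodic_shift[of P \<tau> h, OF P1 P2 per]
  have ana: "h analytic_on {x}" if "x \<notin> P" for x
    using hol opn that analytic_at by blast
  have ev: "eventually (\<lambda>y. y \<notin> P) (at x)" for x
  proof (cases "x \<in> P")
    case False
    thus ?thesis using opn unfolding eventually_at_topological by blast
  next
    case True
    have "\<forall>\<^sub>F y in at x. y \<in> ball x \<delta> - {x}"
      unfolding eventually_at using \<delta> by (intro exI[of _ \<delta>]) (auto simp: dist_commute)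
    thus ?thesis by eventually_elim (use sep True in \<open>auto simp: dist_commute\<close>)
  qed
  have iso: "isolated_singularity_at h x" for x
  proof -
    obtain r where "r > 0" "\<And>y. y \<noteq> x \<Longrightarrow> dist y x < r \<Longrightarrow> y \<notin> P"
      using ev[of x] unfolding eventually_at by blast
    hence "h analytic_on ball x r - {x}"
      by (subst analytic_on_analytic_at) (auto intro!: ana simp: dist_commute)
    thus ?thesis using \<open>r > 0\<close> unfolding isolated_singularity_at_def by blast
  qed
  have lim_w: "\<exists>c. h \<midarrow>w\<rightarrow> c"
  proof -
    have wP: "w \<in> P" unfolding P_def by (auto intro: exI[of _ 0])
    have "ball w \<delta> - {w} \<subseteq> - P"
      using sep[OF wP] by (auto simp: dist_commute)
    hence "h holomorphic_on ball w \<delta> - {w}"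
      using hol holomorphic_on_subset by blast
    from holomorphic_on_extend_lim[OF this] lim \<delta>
    obtain g where g: "g holomorphic_on ball w \<delta>" "\<forall>z\<in>ball w \<delta> - {w}. g z = h z"
      by auto
    have "isCont g w"
      using holomorphic_on_imp_continuous_on[OF g(1)] \<delta> by (simp add: continuous_on_eq_continuous_at)
    hence "g \<midarrow>w\<rightarrow> g w" by (simp add: isCont_def)
    moreover have "\<forall>\<^sub>F y in at w. g y = h y"
      unfolding eventually_at by (rule exI[of _ \<delta>]) (use g(2) \<delta> in \<open>auto simp: dist_commute\<close>)
    ultimately have "h \<midarrow>w\<rightarrow> g w" using tendsto_cong by blast
    thus ?thesis by blast
  qed
  \<comment> \<open>Transporting a limit uses the functional equations only in a punctured
    neighbourhood, so the single limit at \<open>w\<close> gives limits at all points of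
    \<open>P\<close>, up to sign.\<close>
  have lim_shift: "h \<midarrow>x + of_int m + of_int n * \<tau>\<rightarrow> (if even n then 1 else -1) * c" if "h \<midarrow>x\<rightarrow> c" for x c m n
  proof -
    define l where "l = of_int m + of_int n * \<tau>"
    have "((\<lambda>y. (if even n then 1 else -1) * h y) \<longlongrightarrow> (if even n then 1 else -1) * c) (at x)"
      by (intro tendsto_intros that)
    moreover have "\<forall>\<^sub>F y in at x. (if even n then 1 else -1) * h y = h (y + l)"
      using ev[of x] by eventually_elim (use h_shift in \<open>simp add: l_def add.assoc\<close>)
    ultimately have "((\<lambda>y. h (y + l)) \<longlongrightarrow> (if even n then 1 else -1) * c) (at x)"
      by (rule Lim_transform_eventually)
    from LIM_offset[OF this, of "-l"] have "h \<midarrow>x + l\<rightarrow> (if even n then 1 else -1) * c"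
      by simp
    thus ?thesis by (simp add: l_def add.assoc)
  qed
  have lims: "h \<midarrow>x\<rightarrow> remove_sings h x" for x
  proof -
    have "\<exists>c. h \<midarrow>x\<rightarrow> c"
    proof (cases "x \<in> P")
      case True
      then obtain m n where "x = w + of_int m + of_int n * \<tau>" unfolding P_def by blast
      thus ?thesis using lim_w lim_shift by blast
    next
      case False
      thus ?thesis using ana analytic_at_imp_isCont isContD by blast
    qed
    then obtain c where "h \<midarrow>x\<rightarrow> c" by blast
    thus ?thesis using remove_sings_eqI[of h c x] by simp
  qed
  have g_shift: "remove_sings h (x + of_int m + of_int n * \<tau>) = (if even n then 1 else -1) * remove_sings h x" for x m n
    by (rule remove_sings_eqI, rule lim_shift, rule lims)
  have g_hol: "remove_sings h holomorphic_on UNIV"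
  proof -
    have "remove_sings h analytic_on {x}" for x
      by (rule remove_sings_analytic_at[OF iso lims])
    hence "remove_sings h analytic_on UNIV"
      by (subst analytic_on_analytic_at) auto
    thus ?thesis by (rule analytic_imp_holomorphic)
  qed
  \<comment> \<open>\<open>K\<close> is the closed fundamental parallelogram. Lattice translations
    change the extension only by a sign, so a bound on \<open>K\<close> is a bound
    everywhere.\<close>
  define K where "K = (\<lambda>(x::real, y::real). of_real x + of_real y * \<tau>) ` ({0..1} \<times> {0..1})"
  have "compact K" unfolding K_def
    by (intro compact_continuous_image compact_Times compact_Icc)
       (auto simp: case_prod_unfold intro!: continuous_intros)
  hence "bounded (remove_sings h ` K)"
    by (intro compact_imp_bounded compact_continuous_image holomorphic_on_imp_continuous_on)
       (use g_hol holomorphic_on_subset in blast)+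
  then obtain M where M: "\<And>x. x \<in> K \<Longrightarrow> norm (remove_sings h x) \<le> M"
    by (auto simp: bounded_iff)
  have "norm (remove_sings h x) \<le> M" for x
  proof -
    define b where "b = Im x / Im \<tau>"
    define a where "a = Re x - b * Re \<tau>"
    have x: "x = of_real a + of_real b * \<tau>"
      using \<tau> by (simp add: complex_eq_iff a_def b_def)
    define x0 where "x0 = of_real (frac a) + of_real (frac b) * \<tau>"
    have x0: "x0 \<in> K" unfolding K_def x0_def
      by (rule image_eqI[of _ _ "(frac a, frac b)"]) (auto simp: frac_lt_1 less_imp_le)
    have "x = x0 + of_int \<lfloor>a\<rfloor> + of_int \<lfloor>b\<rfloor> * \<tau>"
      by (simp add: x x0_def frac_def algebra_simps)
    hence "norm (remove_sings h x) = norm (remove_sings h x0)"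
      using g_shift[of x0 "\<lfloor>a\<rfloor>" "\<lfloor>b\<rfloor>"] by (simp add: norm_mult)
    thus ?thesis using M[OF x0] by simp
  qed
  hence "bounded (range (remove_sings h))"
    by (auto simp: bounded_iff)
  with g_hol have "remove_sings h constant_on UNIV"
    by (rule Liouville_theorem)
  then obtain c where c: "\<And>x. remove_sings h x = c"
    by (auto simp: constant_on_def)
  \<comment> \<open>Translation by \<tau> turns the constant into its negative.\<close>
  have "c = 0" using g_shift[of 0 0 1] c by simp
  thus ?thesis using c remove_sings_at_analytic[OF ana[OF z]] by simp
qed

subsection \<open>Infinite products and Lambert-type series\<close>

text \<open>This is the q-Pochhammer symbol (-u; q)_infinity, the E(u) of the overview with the nome
  as an explicit argument, because Euler's identity mixes the nomes q and q^2.\<close>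

definition qprod :: "complex \<Rightarrow> complex \<Rightarrow> complex" where
  "qprod q u = (\<Prod>k. 1 + u * q ^ k)"

lemma convergent_qprod: "norm q < 1 \<Longrightarrow> convergent_prod (\<lambda>k. 1 + u * q ^ k :: complex)"
  by (intro abs_convergent_prod_imp_convergent_prod summable_imp_abs_convergent_prod)
     (auto simp: norm_mult norm_power intro!: summable_mult summable_geometric)

lemma qprod_step:
  assumes "norm q < 1"
  shows "qprod q u = (1 + u) * qprod q (q * u)"
proof -
  have "qprod q u = (\<Prod>k<1. 1 + u * q ^ k) * (\<Prod>k. 1 + u * q ^ (k + 1))"
    unfolding qprod_def
    by (rule has_prod_unique[symmetric], rule has_prod_ignore_initial_segment', rule convergent_qprod) fact
  thus ?thesis by (simp add: qprod_def mult_ac)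
qed

lemma qprod_eq_0_iff:
  assumes "norm q < 1"
  shows "qprod q u = 0 \<longleftrightarrow> (\<exists>k. u * q ^ k = -1)"
proof -
  have "(\<lambda>k. 1 + u * q ^ k) has_prod qprod q u"
    unfolding qprod_def by (intro convergent_prod_has_prod convergent_qprod assms)
  from has_prod_eq_0_iff[OF this] show ?thesis
    by (metis (no_types, lifting) add_eq_0_iff rangeE rangeI)
qed

lemma holomorphic_qprod:
  assumes "norm q < 1"
  shows "qprod q holomorphic_on UNIV"
proof (rule holomorphic_uniform_sequence)
  show "(\<lambda>u. \<Prod>k<n. 1 + u * q ^ k) holomorphic_on UNIV" for n
    by (intro holomorphic_intros)
  fix x :: complex
  have "uniformly_convergent_on (cball x 1) (\<lambda>N u. \<Sum>k<N. norm (u * q ^ k))"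
  proof (rule Weierstrass_m_test'_ev)
    show "\<forall>\<^sub>F k in sequentially. \<forall>u\<in>cball x 1. norm (norm (u * q ^ k)) \<le> (norm x + 1) * norm q ^ k"
    proof (intro always_eventually allI ballI)
      fix k u assume u: "u \<in> cball x 1"
      have "norm u \<le> norm x + 1"
        using u norm_triangle_ineq2[of u x] by (simp add: dist_norm norm_minus_commute)
      thus "norm (norm (u * q ^ k)) \<le> (norm x + 1) * norm q ^ k"
        by (simp add: norm_mult norm_power mult_right_mono)
    qed
    show "summable (\<lambda>k. (norm x + 1) * norm q ^ k)"
      using assms by (intro summable_mult summable_geometric) auto
  qed
  hence "uniformly_convergent_on (cball x 1) (\<lambda>N u. \<Prod>k<N. 1 + u * q ^ k)"
    by (intro uniformly_convergent_on_prod) (auto intro!: continuous_intros)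
  then obtain l where l: "uniform_limit (cball x 1) (\<lambda>N u. \<Prod>k<N. 1 + u * q ^ k) l sequentially"
    by (auto simp: uniformly_convergent_on_def)
  have "l u = qprod q u" if "u \<in> cball x 1" for u
  proof -
    have "(\<lambda>N. \<Prod>k<N. 1 + u * q ^ k) \<longlonglongrightarrow> l u"
      using tendsto_uniform_limitI[OF l that] .
    moreover have "(\<lambda>N. \<Prod>k<N. 1 + u * q ^ k) \<longlonglongrightarrow> qprod q u"
      unfolding qprod_def by (intro has_prod_imp_tendsto' convergent_prod_has_prod convergent_qprod assms)
    ultimately show ?thesis by (rule LIMSEQ_unique)
  qed
  hence "uniform_limit (cball x 1) (\<lambda>N u. \<Prod>k<N. 1 + u * q ^ k) (qprod q) sequentially"
    using l by (subst (asm) uniform_limit_cong') auto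
  thus "\<exists>d>0. cball x d \<subseteq> UNIV \<and> uniform_limit (cball x d) (\<lambda>N u. \<Prod>k<N. 1 + u * q ^ k) (qprod q) sequentially"
    by (intro exI[of _ 1]) auto
qed auto

text \<open>The sum is what iterating g u = t u + s * g (q * u) produces. Keeping \<open>t\<close>
  and \<open>s\<close> abstract lets one theory serve both series of \<open>ND\<close>.\<close>

definition lambert_series :: "(complex \<Rightarrow> complex) \<Rightarrow> complex \<Rightarrow> complex \<Rightarrow> complex \<Rightarrow> complex" where
  "lambert_series t s q u = (\<Sum>k. s ^ k * t (u * q ^ k))"

text \<open>\<open>B\<close> holds the poles of \<open>t\<close>; lying on the unit circle, they
  stay away from the small arguments at which the tail is evaluated. The linear bound gives
  geometric decay of the terms and t 0 = 0.\<close>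

locale lambert_term =
  fixes t :: "complex \<Rightarrow> complex" and s q :: complex and B :: "complex set"
  assumes q: "norm q < 1" and s: "norm s \<le> 1"
    and B: "finite B" "\<And>x. x \<in> B \<Longrightarrow> norm x = 1"
    and t_hol: "t holomorphic_on - B"
    and t_bound: "\<And>x. norm x \<le> 1/2 \<Longrightarrow> norm (t x) \<le> 2 * norm x"
begin

lemma term_bound:
  assumes "norm (u * q ^ k) \<le> 1/2"
  shows "norm (s ^ k * t (u * q ^ k)) \<le> 2 * norm u * norm q ^ k"
proof -
  have "norm (s ^ k * t (u * q ^ k)) \<le> 1 * (2 * norm (u * q ^ k))"
    unfolding norm_mult[of "s ^ k"] norm_power using s assms
    by (intro mult_mono t_bound power_le_one) auto
  thus ?thesis by (simp add: norm_mult norm_power)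
qed

lemma ev_small: "\<forall>\<^sub>F k in sequentially. norm (u * q ^ k) < 1/2"
proof -
  have "(\<lambda>k. norm (u * q ^ k)) \<longlonglongrightarrow> norm (u * 0)"
    by (intro tendsto_intros LIMSEQ_power_zero q)
  thus ?thesis by (rule order_tendstoD) auto
qed

lemma summable_lambert_series: "summable (\<lambda>k. s ^ k * t (u * q ^ k))"
proof (rule summable_comparison_test_ev)
  show "\<forall>\<^sub>F k in sequentially. norm (s ^ k * t (u * q ^ k)) \<le> 2 * norm u * norm q ^ k"
    using ev_small[of u] by eventually_elim (rule term_bound, simp)
  show "summable (\<lambda>k. 2 * norm u * norm q ^ k)"
    using q by (intro summable_mult summable_geometric) auto
qed

text \<open>Finitely many terms, where poles can occur, are separated from a tail that is the same
  series at an argument as close to 0 as desired.\<close>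

lemma lambert_series_split: "lambert_series t s q u = (\<Sum>k<n. s ^ k * t (u * q ^ k)) + s ^ n * lambert_series t s q (u * q ^ n)"
proof -
  have "(\<Sum>k. s ^ (k + n) * t (u * q ^ (k + n))) = (\<Sum>k. s ^ n * (s ^ k * t (u * q ^ n * q ^ k)))"
    by (simp add: power_add mult_ac)
  also have "\<dots> = s ^ n * lambert_series t s q (u * q ^ n)"
    unfolding lambert_series_def by (rule suminf_mult[OF summable_lambert_series])
  finally show ?thesis
    using suminf_split_initial_segment[OF summable_lambert_series[of u], of n] by (simp add: lambert_series_def)
qed

lemma lambert_series_step: "lambert_series t s q u = t u + s * lambert_series t s q (q * u)"
  using lambert_series_split[of u 1] by (simp add: mult_ac)

lemma small_not_B: "norm x < 1/2 \<Longrightarrow> x \<notin> B"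
  using B(2) by force

lemma lambert_series_holomorphic_near_0: "lambert_series t s q holomorphic_on ball 0 (1/2)"
proof (rule holomorphic_uniform_sequence)
  have small: "norm (u * q ^ k) \<le> norm u" for u k
    using q mult_left_mono[of "norm q ^ k" 1 "norm u"] by (simp add: norm_mult norm_power power_le_one)
  show "(\<lambda>u. \<Sum>k<n. s ^ k * t (u * q ^ k)) holomorphic_on ball 0 (1/2)" for n
  proof (intro holomorphic_intros holomorphic_on_compose_gen[OF _ t_hol, unfolded o_def])
    fix k show "(\<lambda>u. u * q ^ k) ` ball 0 (1/2) \<subseteq> - B"
    proof safe
      fix u :: complex assume "u \<in> ball 0 (1/2)" "u * q ^ k \<in> B"
      thus False using small[of u k] small_not_B[of "u * q ^ k"] by simp
    qed
  qed
  fix x :: complex assume x: "x \<in> ball 0 (1/2)"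
  then obtain d where d: "d > 0" "cball x d \<subseteq> ball 0 (1/2)"
    using open_contains_cball by blast
  have "uniform_limit (cball x d) (\<lambda>n u. \<Sum>k<n. s ^ k * t (u * q ^ k)) (lambert_series t s q) sequentially"
    unfolding lambert_series_def
  proof (rule Weierstrass_m_test)
    fix k u assume "u \<in> cball x d"
    hence u: "norm u < 1/2" using d by auto
    have "norm (s ^ k * t (u * q ^ k)) \<le> 2 * norm u * norm q ^ k"
      by (rule term_bound) (use small[of u k] u in linarith)
    also have "\<dots> \<le> 1 * norm q ^ k"
      using u by (intro mult_right_mono) auto
    finally show "norm (s ^ k * t (u * q ^ k)) \<le> 1 * norm q ^ k" .
  next
    show "summable (\<lambda>k. 1 * norm q ^ k)"
      using q by (intro summable_mult summable_geometric) auto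
  qed
  thus "\<exists>d>0. cball x d \<subseteq> ball 0 (1/2) \<and>
      uniform_limit (cball x d) (\<lambda>n u. \<Sum>k<n. s ^ k * t (u * q ^ k)) (lambert_series t s q) sequentially"
    using d by blast
qed auto

lemma lambert_series_analytic:
  assumes u: "\<And>k. u * q ^ k \<notin> B"
  shows "lambert_series t s q analytic_on {u}"
proof -
  obtain n where n: "norm (u * q ^ n) < 1/2"
    using eventually_happens[OF ev_small[of u]] by auto
  \<comment> \<open>On this neighbourhood of \<open>u\<close> the first \<open>n\<close> terms avoid
    the poles of \<open>t\<close>, and the tail is evaluated inside the disc where holomorphy is
    already known.\<close>
  define S where "S = (\<Inter>k<n. (\<lambda>x. x * q ^ k) -` (- B)) \<inter> (\<lambda>x. x * q ^ n) -` ball 0 (1/2)"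
  have "open S" unfolding S_def
    by (intro open_Int open_INT ballI continuous_on_open_vimage[THEN iffD1, rule_format]
        open_vimage continuous_intros open_Compl finite_imp_closed B open_ball) auto
  have "(\<lambda>x. (\<Sum>k<n. s ^ k * t (x * q ^ k)) + s ^ n * lambert_series t s q (x * q ^ n)) holomorphic_on S"
    by (intro holomorphic_intros holomorphic_on_compose_gen[OF _ t_hol, unfolded o_def]
       holomorphic_on_compose_gen[OF _ lambert_series_holomorphic_near_0, unfolded o_def]) (auto simp: S_def)
  hence "lambert_series t s q holomorphic_on S"
    by (subst lambert_series_split[of _ n, abs_def])
  moreover have "u \<in> S" using u n by (auto simp: S_def)
  ultimately show ?thesis using \<open>open S\<close> analytic_at by blast
qed

lemma lambert_series_0: "lambert_series t s q 0 = 0"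
  using t_bound[of 0] by (simp add: lambert_series_def)

lemma lambert_series_isCont_0: "isCont (lambert_series t s q) 0"
  by (intro analytic_at_imp_isCont lambert_series_analytic) (use small_not_B[of 0] in auto)

text \<open>Iterating the functional equation pushes the argument to \<open>0\<close>.\<close>
lemma lambert_series_unique:
  assumes g: "isCont g 0" "g 0 = 0"
    and step: "\<And>x. norm x < 1 \<Longrightarrow> g x = t x + s * g (q * x)"
    and u: "norm u < 1"
  shows "g u = lambert_series t s q u"
proof -
  define d where "d x = g x - lambert_series t s q x" for x
  have small: "norm (q ^ n * u) < 1" for n
    using q u mult_right_mono[of "norm q ^ n" 1 "norm u"]
    by (simp add: norm_mult norm_power power_le_one)
  have "norm (d u) \<le> norm (d (q ^ n * u))" for n
  proof (induction n)
    case (Suc n)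
    have "d (q ^ n * u) = s * d (q * (q ^ n * u))"
      using step[OF small[of n]] lambert_series_step[of "q ^ n * u"] by (simp add: d_def algebra_simps)
    hence "norm (d (q ^ n * u)) \<le> norm (d (q ^ Suc n * u))"
      using s mult_right_mono[of "norm s" 1 "norm (d (q * (q ^ n * u)))"] by (simp add: norm_mult mult_ac)
    thus ?case using Suc by linarith
  qed auto
  moreover have "(\<lambda>n. norm (d (q ^ n * u))) \<longlonglongrightarrow> 0"
  proof -
    have "isCont d 0" unfolding d_def by (intro continuous_intros g lambert_series_isCont_0)
    moreover have "(\<lambda>n. q ^ n * u) \<longlonglongrightarrow> 0"
      using tendsto_mult_right[OF LIMSEQ_power_zero[OF q], of u] by simp
    ultimately have "(\<lambda>n. d (q ^ n * u)) \<longlonglongrightarrow> d 0"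
      by (rule isCont_tendsto_compose)
    moreover have "d 0 = 0" using g lambert_series_0 by (simp add: d_def)
    ultimately show ?thesis using tendsto_norm_zero by fastforce
  qed
  ultimately have "norm (d u) \<le> 0"
    using LIMSEQ_le_const by blast
  thus ?thesis by (simp add: d_def)
qed

end

section \<open>Euler's identity for infinite products\<close>

lemma qprod_even_odd:
  assumes "norm q < 1"
  shows "qprod q u = qprod (q\<^sup>2) u * qprod (q\<^sup>2) (u * q)"
proof -
  have q2: "norm (q\<^sup>2) < 1"
    using assms by (simp add: norm_power power_less_one_iff)
  have lim: "(\<lambda>n. \<Prod>k<n. 1 + u * q ^ k) \<longlonglongrightarrow> qprod q u" if "norm q < 1" for q u
    unfolding qprod_def by (intro has_prod_imp_tendsto' convergent_prod_has_prod convergent_qprod that)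
  have "(\<lambda>n. (\<Prod>k<n. 1 + u * (q\<^sup>2) ^ k) * (\<Prod>k<n. 1 + (u * q) * (q\<^sup>2) ^ k)) \<longlonglongrightarrow>
          qprod (q\<^sup>2) u * qprod (q\<^sup>2) (u * q)"
    by (intro tendsto_mult lim q2)
  \<comment> \<open>The \<open>n\<close> even and \<open>n\<close> odd exponents together are the
    first 2n exponents, so the limit on the other side is taken along even indices.\<close>
  moreover have "(\<Prod>k<n. 1 + u * (q\<^sup>2) ^ k) * (\<Prod>k<n. 1 + (u * q) * (q\<^sup>2) ^ k) = (\<Prod>k<2 * n. 1 + u * q ^ k)" for n
  proof (induction n)
    case (Suc n)
    have "(\<Prod>k<2 * Suc n. 1 + u * q ^ k) = (\<Prod>k<2 * n. 1 + u * q ^ k) * ((1 + u * (q\<^sup>2) ^ n) * (1 + (u * q) * (q\<^sup>2) ^ n))"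
      by (simp add: power_mult[symmetric] mult_ac)
    thus ?case unfolding Suc[symmetric] by (simp add: mult_ac)
  qed auto
  moreover have "(\<lambda>n. \<Prod>k<2 * n. 1 + u * q ^ k) \<longlonglongrightarrow> qprod q u"
    using LIMSEQ_subseq_LIMSEQ[OF lim[OF assms], of "\<lambda>n. 2 * n"] by (simp add: strict_mono_def o_def)
  ultimately show ?thesis
    using LIMSEQ_unique by auto
qed

lemma qprod_nonzero:
  assumes "norm q < 1" "norm u < 1"
  shows "qprod q u \<noteq> 0"
proof
  assume "qprod q u = 0"
  then obtain k where "u * q ^ k = -1" using qprod_eq_0_iff[OF assms(1)] by blast
  hence "norm u * norm q ^ k = 1" by (metis norm_minus_cancel norm_mult norm_one norm_power)
  moreover have "norm u * norm q ^ k \<le> norm u * 1"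
    using assms by (intro mult_left_mono power_le_one) auto
  ultimately show False using assms by simp
qed

text \<open>Multiply by prod (1 - q^n): with prod (1 + q^n) it gives prod (1 - q^(2n)), while
  splitting it by parity gives the same product times prod (1 - q^(2n-1)). The nonzero factor then
  cancels.\<close>

lemma qprod_euler:
  assumes "norm q < 1"
  shows "qprod q q * qprod (q\<^sup>2) (- q) = 1"
proof -
  have "qprod q (- q) * qprod q q = (\<Prod>k. (1 + - q * q ^ k) * (1 + q * q ^ k))"
    unfolding qprod_def by (intro prodinf_mult convergent_qprod assms)
  also have "\<dots> = qprod (q\<^sup>2) (- (q\<^sup>2))"
    unfolding qprod_def by (intro arg_cong[of _ _ prodinf] ext) (simp add: algebra_simps power2_eq_square power_mult_distrib)
  finally have "qprod q (- q) * qprod q q = qprod (q\<^sup>2) (- (q\<^sup>2))" .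
  moreover have "qprod q (- q) = qprod (q\<^sup>2) (- q) * qprod (q\<^sup>2) (- (q\<^sup>2))"
    using qprod_even_odd[OF assms, of "- q"] by (simp add: power2_eq_square)
  ultimately have "qprod q (- q) * (qprod q q * qprod (q\<^sup>2) (- q)) = qprod q (- q) * 1"
    by (metis mult.assoc mult.commute mult.right_neutral)
  thus ?thesis using qprod_nonzero[of q "- q"] assms by simp
qed

section \<open>Auxiliary facts on exponentials, power series and simple zeros\<close>

lemma exp_2pi_i_eq_minus_1: "exp (2 * \<i> * of_real pi * x) = -1 \<longleftrightarrow> (\<exists>m::int. x = 1 / 2 + of_int m)"
proof -
  have "exp (2 * \<i> * of_real pi * x) = -1 \<longleftrightarrow> exp (2 * \<i> * of_real pi * x) = exp (\<i> * of_real pi)"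
    by simp
  also have "\<dots> \<longleftrightarrow> (\<exists>m::int. x = 1 / 2 + of_int m)"
  proof -
    have "2 * \<i> * of_real pi * x = \<i> * of_real pi + of_int (2 * m) * of_real pi * \<i> \<longleftrightarrow> x = 1 / 2 + of_int m" for m
    proof -
      have "\<i> * of_real pi + of_int (2 * m) * of_real pi * \<i> = 2 * \<i> * of_real pi * (1 / 2 + of_int m)"
        by (simp add: algebra_simps)
      thus ?thesis by (simp only: mult_cancel_left) simp
    qed
    thus ?thesis unfolding exp_eq by (simp only: of_real_mult of_real_of_int_eq)
  qed
  finally show ?thesis .
qed

text \<open>Supplies convergence on the unit disc and the continuity at 0 that
  \<open>lambert_series_unique\<close> asks for.\<close>

lemma bounded_coeff_powser:
  fixes c :: "nat \<Rightarrow> complex"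
  assumes "\<And>n. norm (c n) \<le> M"
  shows "norm x < 1 \<Longrightarrow> summable (\<lambda>n. c n * x ^ n)"
    and "isCont (\<lambda>x. \<Sum>n. c n * x ^ n) 0"
proof -
  show *: "summable (\<lambda>n. c n * x ^ n)" if "norm x < 1" for x
  proof (rule summable_comparison_test[of _ "\<lambda>n. M * norm x ^ n"])
    show "\<exists>N. \<forall>n\<ge>N. norm (c n * x ^ n) \<le> M * norm x ^ n"
      using assms by (auto simp: norm_mult norm_power intro!: mult_right_mono)
    show "summable (\<lambda>n. M * norm x ^ n)"
      using that by (intro summable_mult summable_geometric) auto
  qed
  show "isCont (\<lambda>x. \<Sum>n. c n * x ^ n) 0"
    by (rule isCont_powser[of _ "1/2"]) (use *[of "1/2"] in auto)
qed

lemma one_plus_square_eq_0_iff: "1 + x\<^sup>2 = 0 \<longleftrightarrow> x \<in> {\<i>, -\<i>}" for x :: complex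
proof -
  have "1 + x\<^sup>2 = (x - \<i>) * (x + \<i>)" by (simp add: algebra_simps power2_eq_square)
  thus ?thesis by (auto simp: add_eq_0_iff2)
qed

lemma analytic_uminus_comp: "f analytic_on UNIV \<Longrightarrow> (\<lambda>z. f (- z)) analytic_on A" for f :: "complex \<Rightarrow> complex"
  by (rule analytic_on_compose_gen[of uminus _ f UNIV, unfolded o_def]) (auto intro!: analytic_intros)

text \<open>The residue of 1/f at a simple zero of f, phrased as a limit.\<close>

lemma recip_quotient_limit:
  fixes f :: "complex \<Rightarrow> complex"
  assumes "(f has_field_derivative c) (at w)" "f w = 0" "c \<noteq> 0"
  shows "((\<lambda>z. (z - w) / f z) \<longlongrightarrow> 1 / c) (at w)"
proof -
  have "((\<lambda>z. (f z - f w) / (z - w)) \<longlongrightarrow> c) (at w)"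
    using assms(1) by (simp add: has_field_derivative_iff)
  from tendsto_inverse[OF this assms(3)] show ?thesis
    by (simp add: assms(2) field_simps)
qed

lemma norm_power_Suc_le: "norm q < 1 \<Longrightarrow> norm (q ^ Suc n) \<le> norm q" for q :: complex
  using mult_left_le[of "norm q ^ n" "norm q"] by (simp add: norm_mult norm_power power_le_one)

text \<open>Expanding the fraction by \<open>2 * b\<close> (with an extra factor \<i> for the sine)
  leaves denominators in b^2 alone, for which \<open>q ^ Suc n\<close> and
  \<open>r ^ (2 * n + 1)\<close> are substituted later.\<close>

lemma cos_quotient:
  fixes a b :: complex
  assumes "a \<noteq> 0" "b \<noteq> 0"
  shows "((a + inverse a) / 2) / ((b + inverse b) / 2) = (a * b + b / a) / (1 + b\<^sup>2)"
    and "((a + inverse a) / 2) / (- \<i> * (inverse b - b) / 2) = \<i> * (a * b + b / a) / (1 - b\<^sup>2)"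
proof -
  have ab: "a * b + b / a = (a + inverse a) * b"
    using assms by (simp add: field_simps)
  have *: "(b + inverse b) / 2 = (1 + b\<^sup>2) / (2 * b)"
    using assms by (simp add: field_simps power2_eq_square)
  thus "((a + inverse a) / 2) / ((b + inverse b) / 2) = (a * b + b / a) / (1 + b\<^sup>2)"
    unfolding ab * using assms by simp
  have *: "- \<i> * (inverse b - b) / 2 = (1 - b\<^sup>2) / (2 * \<i> * b)"
    using assms by (simp add: divide_eq_eq eq_divide_eq) (simp add: field_simps power2_eq_square)
  show "((a + inverse a) / 2) / (- \<i> * (inverse b - b) / 2) = \<i> * (a * b + b / a) / (1 - b\<^sup>2)"
    unfolding * ab using assms by simp
qed

subsection \<open>The product and the two series as functions on the plane\<close>

locale half_plane_point =
  fixes \<tau> :: complex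
  assumes Im_pos: "Im \<tau> > 0"
begin

definition q where "q = exp (2 * \<i> * of_real pi * \<tau>)"
text \<open>The nome of -1/\<tau>, which again lies in the upper half plane.\<close>

definition r where "r = exp (- (\<i> * of_real pi / \<tau>))"
definition u where "u z = exp (2 * \<i> * of_real pi * z + \<i> * of_real pi * \<tau>)"
text \<open>Formally exp (pi i z / \<tau>) times the square root of \<open>r\<close>, just as
  \<open>u\<close> contains the square root of \<open>q\<close>; writing the roots as exponentials
  fixes the branch. The analogue of u z * u (- z) = q is X z * X (- z) = r.\<close>

definition X where "X z = exp (\<i> * of_real pi * z / \<tau> - \<i> * of_real pi / (2 * \<tau>))"
text \<open>This representative of the coset satisfies \<open>u w\<^sub>0 = -1\<close>, so the pole
  there sits in the term with index 0.\<close>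

definition w\<^sub>0 where "w\<^sub>0 = 1 / 2 - \<tau> / 2"
definition P where "P = {w\<^sub>0 + of_int m + of_int n * \<tau> | m n. True}"

text \<open>Expanding 1 / (1 + q^n) gives the alternating sign \<open>-1\<close>, and the sum over n
  at fixed k is geometric with value x / (1 + x), x = u q^k. For 1 / (1 - r^(2n+1)) the sign is
  \<open>1\<close>, and odd powers sum to x / (1 + x^2).\<close>

abbreviation lam1 where "lam1 \<equiv> lambert_series (\<lambda>x. x / (1 + x)) (- 1) q"
abbreviation lam2 where "lam2 \<equiv> lambert_series (\<lambda>x. x / (1 + x\<^sup>2)) 1 r"

text \<open>
  The second variable \<open>v\<close> of the header is \<open>u (- z)\<close>. The product \<open>F\<close> already takes the value \<open>0\<close> on
  its poles because \<open>x / 0 = 0\<close>, whereas the values of \<open>S\<close> and \<open>T\<close> on \<open>P\<close> carry no meaning.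
\<close>
definition C where "C = qprod (q\<^sup>2) (- q) ^ 2 * qprod q (- q) ^ 2"
definition D where "D z = qprod q (u z) * qprod q (u (- z))"
definition F where "F z = C * (qprod q (- u z) * qprod q (- u (- z))) / D z"
definition S where "S z = 1 - 2 * (lam1 (u z) + lam1 (u (- z)))"
definition T where "T z = 2 * \<i> / \<tau> * (lam2 (X z) + lam2 (X (- z)))"

lemma tau_nz [simp]: "\<tau> \<noteq> 0" using Im_pos by auto

lemma norm_q: "norm q < 1"
  using Im_pos by (simp add: q_def)

lemma Im_inverse_tau: "Im (1 / \<tau>) < 0"
  using Im_pos by (simp add: Im_divide power2_eq_square divide_neg_pos sum_power2_gt_zero_iff del: power2_eq_square)

lemma norm_r: "norm r < 1"
proof -
  have "Re (- (\<i> * of_real pi / \<tau>)) = pi * Im (1 / \<tau>)"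
    by (simp add: Re_divide Im_divide)
  thus ?thesis using Im_inverse_tau unfolding r_def norm_exp_eq_Re
    by (simp add: mult_pos_neg)
qed

lemma q_nz [simp]: "q \<noteq> 0" and r_nz [simp]: "r \<noteq> 0" and u_nz [simp]: "u z \<noteq> 0" and X_nz [simp]: "X z \<noteq> 0"
  by (simp_all add: q_def r_def u_def X_def)

sublocale L1: lambert_term "\<lambda>x. x / (1 + x)" "-1" q "{-1}"
proof
  show "(\<lambda>x. x / (1 + x)) holomorphic_on - {-1}"
    by (intro holomorphic_intros) (auto simp: add_eq_0_iff)
  fix x :: complex assume x: "norm x \<le> 1/2"
  have "norm (1 + x) \<ge> 1 / 2" using norm_triangle_ineq2[of 1 "-x"] x by simp
  hence "norm x / norm (1 + x) \<le> norm x / (1/2)"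
    by (intro divide_left_mono) auto
  thus "norm (x / (1 + x)) \<le> 2 * norm x" by (simp add: norm_divide)
qed (auto simp: norm_q)

sublocale L2: lambert_term "\<lambda>x. x / (1 + x\<^sup>2)" 1 r "{\<i>, -\<i>}"
proof
  show "(\<lambda>x. x / (1 + x\<^sup>2)) holomorphic_on - {\<i>, -\<i>}"
    by (intro holomorphic_intros) (use one_plus_square_eq_0_iff in auto)
  fix x :: complex assume x: "norm x \<le> 1/2"
  have "norm x ^ 2 \<le> (1/2) ^ 2" by (intro power_mono x) auto
  hence "norm (x\<^sup>2) \<le> 1 / 4" unfolding norm_power by (simp add: power2_eq_square)
  hence "norm (1 + x\<^sup>2) \<ge> 1 / 2" using norm_triangle_ineq2[of 1 "-x\<^sup>2"] by simp
  hence "norm x / norm (1 + x\<^sup>2) \<le> norm x / (1/2)"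
    by (intro divide_left_mono) auto
  thus "norm (x / (1 + x\<^sup>2)) \<le> 2 * norm x" by (simp add: norm_divide)
qed (auto simp: norm_r)

section \<open>The coset of poles\<close>

lemma u_mult: "u z * q ^ k = exp (2 * \<i> * of_real pi * (z + \<tau> / 2 + of_nat k * \<tau>))"
  unfolding u_def q_def exp_of_nat_mult[symmetric] exp_add[symmetric]
  by (rule arg_cong[of _ _ exp]) (simp add: algebra_simps)

text \<open>The poles of the second series are where the square equals -1, so the same description
  of exp (2 pi i x) = -1 locates the poles of both series.\<close>

lemma X_mult_square: "(X z * r ^ k)\<^sup>2 = exp (2 * \<i> * of_real pi * (z / \<tau> - 1 / (2 * \<tau>) - of_nat k / \<tau>))"
proof -
  have "X z * r ^ k = exp (\<i> * of_real pi * (z / \<tau> - 1 / (2 * \<tau>) - of_nat k / \<tau>))"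
    unfolding X_def r_def exp_of_nat_mult[symmetric] exp_add[symmetric]
    by (rule arg_cong[of _ _ exp]) (simp add: algebra_simps)
  hence "(X z * r ^ k)\<^sup>2 = exp (2 * (\<i> * of_real pi * (z / \<tau> - 1 / (2 * \<tau>) - of_nat k / \<tau>)))"
    by (simp only: exp_double)
  thus ?thesis by (simp only: mult.assoc)
qed

lemma P_iff: "z \<in> P \<longleftrightarrow> (\<exists>m n. z = w\<^sub>0 + of_int m + of_int n * \<tau>)"
  unfolding P_def by blast

lemma P_uminus: "- z \<in> P \<longleftrightarrow> z \<in> P"
proof -
  have "- z \<in> P" if zP: "z \<in> P" for z
  proof -
    obtain m n where "z = w\<^sub>0 + of_int m + of_int n * \<tau>" using zP unfolding P_iff by blast
    hence "- z = w\<^sub>0 + of_int (- m - 1) + of_int (1 - n) * \<tau>"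
      by (simp add: w\<^sub>0_def field_simps)
    thus ?thesis unfolding P_iff by blast
  qed
  from this[of z] this[of "- z"] show ?thesis unfolding minus_minus by blast
qed

lemma u_not_minus_1:
  assumes "z \<notin> P" shows "u z * q ^ k \<noteq> -1"
proof
  assume "u z * q ^ k = -1"
  then obtain m :: int where "z + \<tau> / 2 + of_nat k * \<tau> = 1 / 2 + of_int m"
    unfolding u_mult exp_2pi_i_eq_minus_1 by blast
  moreover have "z = (z + \<tau> / 2 + of_nat k * \<tau>) - \<tau> / 2 - of_nat k * \<tau>"
    by simp
  ultimately have "z = w\<^sub>0 + of_int m + of_int (- int k) * \<tau>"
    by (simp add: w\<^sub>0_def)
  thus False using assms unfolding P_iff by blast
qed

lemma X_not_pm_i:
  assumes "z \<notin> P" shows "X z * r ^ k \<notin> {\<i>, -\<i>}"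
proof
  assume "X z * r ^ k \<in> {\<i>, -\<i>}"
  hence "(X z * r ^ k)\<^sup>2 = -1" using one_plus_square_eq_0_iff by (simp add: add_eq_0_iff)
  then obtain m :: int where "z / \<tau> - 1 / (2 * \<tau>) - of_nat k / \<tau> = 1 / 2 + of_int m"
    unfolding X_mult_square exp_2pi_i_eq_minus_1 by blast
  moreover have "z = \<tau> * (z / \<tau> - 1 / (2 * \<tau>) - of_nat k / \<tau>) + 1 / 2 + of_nat k"
    by (simp add: right_diff_distrib)
  \<comment> \<open>The coefficient m + 1 appears because \<open>w\<^sub>0\<close> already
    contributes -\<tau>/2, whereas the computed point has (m + 1/2) \<tau>.\<close>
  ultimately have "z = w\<^sub>0 + of_int (int k) + of_int (m + 1) * \<tau>"
    by (simp add: w\<^sub>0_def algebra_simps)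
  thus False using assms unfolding P_iff by blast
qed

lemma D_eq_0_iff: "D z = 0 \<longleftrightarrow> z \<in> P"
proof
  assume "D z = 0"
  thus "z \<in> P" using u_not_minus_1[of z] u_not_minus_1[of "- z"] P_uminus[of z]
    unfolding D_def by (auto simp: qprod_eq_0_iff[OF norm_q])
next
  assume "z \<in> P"
  then obtain m n where z: "z = w\<^sub>0 + of_int m + of_int n * \<tau>" unfolding P_iff by blast
  show "D z = 0"
  \<comment> \<open>At this point u z = -q^n and u (- z) = -q^(1-n). The exponent that can be
    cancelled by a natural power of \<open>q\<close> decides which of the two products
    vanishes.\<close>
  proof (cases "n \<le> 0")
    case True
    have "z + \<tau> / 2 + of_nat (nat (- n)) * \<tau> = 1 / 2 + of_int m"
      using True by (simp add: z w\<^sub>0_def algebra_simps)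
    hence "u z * q ^ nat (- n) = -1"
      unfolding u_mult exp_2pi_i_eq_minus_1 by blast
    thus ?thesis unfolding D_def by (auto simp: qprod_eq_0_iff[OF norm_q])
  next
    case False
    have "- z + \<tau> / 2 + of_nat (nat (n - 1)) * \<tau> = 1 / 2 + of_int (- m - 1)"
      using False by (simp add: z w\<^sub>0_def algebra_simps)
    hence "u (- z) * q ^ nat (n - 1) = -1"
      unfolding u_mult exp_2pi_i_eq_minus_1 by blast
    thus ?thesis unfolding D_def by (auto simp: qprod_eq_0_iff[OF norm_q])
  qed
qed

text \<open>In the real basis 1, \<tau> both coordinates of a point of \<open>P\<close> are
  half-integers, so neither defining strip of \<open>ND\<close> meets a pole.\<close>

lemma P_coords:
  assumes "of_real x + of_real y * \<tau> \<in> P"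
  shows "\<bar>x\<bar> \<ge> 1/2" "\<bar>y\<bar> \<ge> 1/2"
proof -
  obtain m n where e: "of_real x + of_real y * \<tau> = w\<^sub>0 + of_int m + of_int n * \<tau>"
    using assms unfolding P_iff by blast
  have "y * Im \<tau> = (of_int n - 1/2) * Im \<tau>"
    using arg_cong[OF e, of Im] by (simp add: w\<^sub>0_def algebra_simps)
  hence y: "y = of_int n - 1/2" using Im_pos by simp
  have "x + y * Re \<tau> = 1/2 - Re \<tau> / 2 + of_int m + of_int n * Re \<tau>"
    using arg_cong[OF e, of Re] by (simp add: w\<^sub>0_def)
  hence "x = of_int m + 1/2"
    unfolding y by (simp add: algebra_simps)
  moreover have "real_of_int k \<ge> 0 \<or> real_of_int k \<le> -1" for k
    using of_int_le_iff[of k "-1", where 'a = real] by (cases "0 \<le> k") auto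
  from this[of m] this[of "n - 1"] calculation show "\<bar>x\<bar> \<ge> 1/2" "\<bar>y\<bar> \<ge> 1/2"
    unfolding y by auto
qed

section \<open>Behaviour under translation by 1 and by \<tau>\<close>

lemma u_shift: "u (z + 1) = u z" "u (- (z + 1)) = u (- z)" "u (z + \<tau>) = q * u z"
    "u (- (z + \<tau>)) = 1 / u z" "u (- z) = q / u z"
proof -
  have exp_2pi: "exp (2 * \<i> * of_real pi) = 1"
    using exp_two_pi_i by (simp only: mult_ac)
  have e: "exp (x + 2 * \<i> * of_real pi) = exp x" "exp (x - 2 * \<i> * of_real pi) = exp x" for x
    by (simp_all add: exp_add exp_diff exp_2pi)
  have "u (z + 1) = exp (2 * \<i> * of_real pi * z + \<i> * of_real pi * \<tau> + 2 * \<i> * of_real pi)"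
    by (simp add: u_def algebra_simps)
  thus "u (z + 1) = u z" by (simp add: e u_def)
  have "u (- (z + 1)) = exp (2 * \<i> * of_real pi * (-z) + \<i> * of_real pi * \<tau> - 2 * \<i> * of_real pi)"
    by (simp add: u_def algebra_simps)
  thus "u (- (z + 1)) = u (-z)" by (simp add: e u_def)
  show "u (z + \<tau>) = q * u z"
    unfolding u_def q_def exp_add[symmetric] by (rule arg_cong[of _ _ exp]) (simp add: algebra_simps)
  have "u (- (z + \<tau>)) * u z = 1"
    unfolding u_def exp_add[symmetric] exp_eq_1 by (auto simp: algebra_simps intro!: exI[of _ 0])
  thus "u (- (z + \<tau>)) = 1 / u z" by (simp add: eq_divide_eq)
  have "u (- z) * u z = q"
    unfolding u_def q_def exp_add[symmetric] by (rule arg_cong[of _ _ exp]) (simp add: algebra_simps)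
  thus "u (- z) = q / u z" by (simp add: eq_divide_eq)
qed

lemma X_shift: "X (z + \<tau>) = - X z" "X (- (z + \<tau>)) = - X (- z)" "X (- (z + 1)) = r * X (- z)"
    "X (z + 1) = 1 / X (- z)"
proof -
  have e: "exp (x + \<i> * of_real pi) = - exp x" "exp (x - \<i> * of_real pi) = - exp x" for x
    by (simp_all add: exp_add exp_diff)
  have "X (z + \<tau>) = exp (\<i> * of_real pi * z / \<tau> - \<i> * of_real pi / (2 * \<tau>) + \<i> * of_real pi)"
    unfolding X_def by (rule arg_cong[of _ _ exp]) (simp add: distrib_left right_diff_distrib add_divide_distrib diff_divide_distrib)
  thus "X (z + \<tau>) = - X z" by (simp only: e X_def)
  have "X (- (z + \<tau>)) = exp (\<i> * of_real pi * (- z) / \<tau> - \<i> * of_real pi / (2 * \<tau>) - \<i> * of_real pi)"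
    unfolding X_def by (rule arg_cong[of _ _ exp]) (simp add: distrib_left right_diff_distrib add_divide_distrib diff_divide_distrib)
  thus "X (- (z + \<tau>)) = - X (- z)" by (simp only: e X_def)
  show "X (- (z + 1)) = r * X (- z)"
    unfolding X_def r_def exp_add[symmetric] by (rule arg_cong[of _ _ exp]) (simp add: field_simps)
  have "X (z + 1) * X (- z) = 1"
    unfolding X_def r_def exp_add[symmetric] by (simp add: field_simps)
  thus "X (z + 1) = 1 / X (- z)" by (simp add: eq_divide_eq)
qed

text \<open>Under \<tau> the denominator acquires the factor 1/u and the numerator -1/u, since (1 -
  1/u) = -(1/u) (1 - u). No division by 1 - u or 1 + u takes place, so the equations hold at every
  z.\<close>

lemma F_shift: "F (z + 1) = F z" "F (z + \<tau>) = - F z"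
proof -
  show "F (z + 1) = F z" unfolding F_def D_def u_shift ..
  note st = qprod_step[OF norm_q]
  have "1 / u z * q = u (- z)" by (simp add: u_shift(5))
  hence a: "qprod q (1 / u z) = (1 + 1 / u z) * qprod q (u (- z))"
      "qprod q (- (1 / u z)) = (1 - 1 / u z) * qprod q (- u (- z))"
    using st[of "1 / u z"] st[of "- (1 / u z)"] by (simp_all add: mult.commute)
  have st_u: "qprod q (- u z) = (1 - u z) * qprod q (- (q * u z))" "qprod q (u z) = (1 + u z) * qprod q (q * u z)"
    using st[of "- u z"] st[of "u z"] by simp_all
  have n: "qprod q (- (q * u z)) * qprod q (- (1 / u z)) = - (1 / u z) * (qprod q (- u z) * qprod q (- u (- z)))"
    unfolding a st_u by (simp add: field_simps)
  have d: "qprod q (q * u z) * qprod q (1 / u z) = (1 / u z) * D z"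
    unfolding a D_def st_u by (simp add: field_simps)
  have D: "D (z + \<tau>) = (1 / u z) * D z"
    unfolding D_def[of "z + \<tau>"] u_shift(3,4) by (rule d)
  show "F (z + \<tau>) = - F z"
    unfolding F_def D u_shift(3,4) n by simp
qed

text \<open>With t x = x / (1 + x) one has t u + t (1/u) = 1, so \<tau> maps the bracket L to 1 - L.
  The leading constant 1 of the series is exactly what turns this into a sign change of 1 - 2 L. At
  u = -1 the identity fails under x / 0 = 0, hence the hypothesis.\<close>

lemma S_shift:
  assumes "z \<notin> P"
  shows "S (z + 1) = S z" "S (z + \<tau>) = - S z"
proof -
  show "S (z + 1) = S z" unfolding S_def u_shift ..
  have "1 / u z * q = u (- z)" by (simp add: u_shift(5))
  hence 1: "lam1 (1 / u z) = (1 / u z) / (1 + 1 / u z) - lam1 (u (- z))"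
    using L1.lambert_series_step[of "1 / u z"] by (simp add: mult.commute)
  have 2: "lam1 (q * u z) = u z / (1 + u z) - lam1 (u z)"
    using L1.lambert_series_step[of "u z"] by simp
  have 3: "u z / (1 + u z) + (1 / u z) / (1 + 1 / u z) = 1"
    using u_not_minus_1[OF assms, of 0] by (simp add: field_simps add_eq_0_iff)
  have "lam1 (q * u z) + lam1 (1 / u z) = 1 - (lam1 (u z) + lam1 (u (- z)))"
    by (simp only: 1 2 add_diff_add[symmetric] 3)
  thus "S (z + \<tau>) = - S z" by (simp only: S_def u_shift) simp
qed

text \<open>Period 1 rests on t x = t (1/x) for t x = x / (1 + x^2), which survives at its poles
  because both sides are then 0. The sign change under \<tau> is the oddness of
  \<open>lam2\<close>.\<close>

lemma T_shift: "T (z + 1) = T z" "T (z + \<tau>) = - T z"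
proof -
  have "X (- z) * X z = r"
    unfolding X_def r_def exp_add[symmetric] by (rule arg_cong[of _ _ exp]) (simp add: field_simps)
  hence "r * (1 / X (- z)) = X z" by (auto simp: field_simps)
  hence "lam2 (1 / X (- z)) = (1 / X (- z)) / (1 + (1 / X (- z))\<^sup>2) + lam2 (X z)"
    using L2.lambert_series_step[of "1 / X (- z)"] by simp
  moreover have "lam2 (r * X (- z)) = lam2 (X (- z)) - X (- z) / (1 + (X (- z))\<^sup>2)"
    using L2.lambert_series_step[of "X (- z)"] by simp
  moreover have "(1 / X (- z)) / (1 + (1 / X (- z))\<^sup>2) = X (- z) / (1 + (X (- z))\<^sup>2)"
    by (simp add: divide_simps power2_eq_square) (simp add: algebra_simps)
  ultimately show "T (z + 1) = T z" unfolding T_def X_shift by simp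
  have "lam2 (- x) = - lam2 x" for x
    unfolding lambert_series_def using suminf_minus[OF L2.summable_lambert_series[of x]] by simp
  thus "T (z + \<tau>) = - T z" unfolding T_def X_shift by (simp only: minus_add_distrib[symmetric] mult_minus_right)
qed

lemma u_analytic: "u analytic_on A" and X_analytic: "X analytic_on A"
  unfolding u_def X_def by (intro analytic_intros; simp)+

lemma qprod_comp_analytic:
  assumes "g analytic_on A"
  shows "(\<lambda>z. qprod q (g z)) analytic_on A"
  by (rule analytic_on_compose_gen[OF assms, of "qprod q" UNIV, unfolded o_def])
     (auto simp: analytic_on_open holomorphic_qprod norm_q)

lemma lam1_comp_analytic:
  assumes "g analytic_on {z}" "\<And>k. g z * q ^ k \<noteq> -1"
  shows "(\<lambda>z. lam1 (g z)) analytic_on {z}"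
  by (rule analytic_on_compose[OF assms(1), of lam1, unfolded o_def]) (use L1.lambert_series_analytic assms in auto)

lemma lam2_comp_analytic:
  assumes "g analytic_on {z}" "\<And>k. g z * r ^ k \<notin> {\<i>, -\<i>}"
  shows "(\<lambda>z. lam2 (g z)) analytic_on {z}"
  by (rule analytic_on_compose[OF assms(1), of lam2, unfolded o_def]) (use L2.lambert_series_analytic[OF assms(2)] in auto)

lemma D_analytic: "D analytic_on A"
  unfolding D_def by (intro analytic_intros qprod_comp_analytic u_analytic analytic_uminus_comp)

lemma F_analytic:
  assumes "z \<notin> P" shows "F analytic_on {z}"
  unfolding F_def using assms D_eq_0_iff
  by (intro analytic_intros qprod_comp_analytic u_analytic analytic_uminus_comp D_analytic) auto

lemma S_analytic:
  assumes "z \<notin> P" shows "S analytic_on {z}"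
  unfolding S_def using assms P_uminus[of z]
  by (intro analytic_intros lam1_comp_analytic u_analytic analytic_uminus_comp u_not_minus_1) auto

lemma T_analytic:
  assumes "z \<notin> P" shows "T analytic_on {z}"
  unfolding T_def using assms P_uminus[of z]
  by (intro analytic_intros lam2_comp_analytic X_analytic analytic_uminus_comp X_not_pm_i) auto

section \<open>The residue at \<open>w\<^sub>0\<close>\<close>

lemma u_w0: "u w\<^sub>0 = -1" and u_minus_w0: "u (- w\<^sub>0) = - q"
proof -
  have "u w\<^sub>0 = exp (\<i> * of_real pi)" unfolding u_def w\<^sub>0_def
    by (rule arg_cong[of _ _ exp]) (simp add: field_simps)
  thus "u w\<^sub>0 = -1" by simp
  thus "u (- w\<^sub>0) = - q" by (simp add: u_shift(5))
qed

lemma X_w0: "X w\<^sub>0 = - \<i>" and X_minus_w0: "X (- w\<^sub>0) = \<i> * r"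
proof -
  have "X w\<^sub>0 = exp (- (\<i> * of_real (pi / 2)))" unfolding X_def w\<^sub>0_def
    by (rule arg_cong[of _ _ exp]) (simp add: field_simps)
  thus *: "X w\<^sub>0 = - \<i>" by (simp add: exp_minus exp_eq_polar cis_pi_half flip: cis_conv_exp)
  have "X (- w\<^sub>0) * X w\<^sub>0 = r"
    unfolding X_def r_def exp_add[symmetric] by (rule arg_cong[of _ _ exp]) (simp add: field_simps)
  moreover have "X (- w\<^sub>0) = \<i> * (X (- w\<^sub>0) * (- \<i>))" by (simp add: complex_eq_iff)
  ultimately show "X (- w\<^sub>0) = \<i> * r" using * by simp
qed

lemma u_limit: "((\<lambda>z. (z - w\<^sub>0) / (1 + u z)) \<longlongrightarrow> \<i> / (2 * of_real pi)) (at w\<^sub>0)"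
proof -
  have der: "((\<lambda>z. 1 + u z) has_field_derivative (2 * \<i> * of_real pi * u w\<^sub>0)) (at w\<^sub>0)"
    unfolding u_def by (auto intro!: derivative_eq_intros)
  have val: "1 / (2 * \<i> * of_real pi * u w\<^sub>0) = \<i> / (2 * of_real pi)"
    by (simp add: u_w0 divide_eq_eq eq_divide_eq)
  show ?thesis using recip_quotient_limit[OF der] unfolding val by (simp add: u_w0)
qed

lemma X_limit: "((\<lambda>z. (z - w\<^sub>0) / (1 + (X z)\<^sup>2)) \<longlongrightarrow> \<tau> * \<i> / (2 * of_real pi)) (at w\<^sub>0)"
proof -
  have der: "((\<lambda>z. 1 + (X z)\<^sup>2) has_field_derivative (2 * X w\<^sub>0 * (X w\<^sub>0 * (\<i> * of_real pi / \<tau>)))) (at w\<^sub>0)"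
    unfolding X_def by (auto intro!: derivative_eq_intros simp: power2_eq_square)
  have val: "1 / (2 * X w\<^sub>0 * (X w\<^sub>0 * (\<i> * of_real pi / \<tau>))) = \<tau> * \<i> / (2 * of_real pi)"
    by (simp add: X_w0 divide_eq_eq eq_divide_eq)
  show ?thesis using recip_quotient_limit[OF der] unfolding val by (simp add: X_w0)
qed

lemma q_power_small: "- q * q ^ k \<noteq> -1"
proof
  assume "- q * q ^ k = -1"
  hence "norm q ^ Suc k = 1" by (metis norm_minus_cancel norm_one norm_power power_Suc mult_minus_left)
  moreover have "norm q ^ Suc k < 1" using norm_q by (intro power_Suc_less_one) auto
  ultimately show False by simp
qed

lemma S_limit: "((\<lambda>z. (z - w\<^sub>0) * S z) \<longlongrightarrow> \<i> / of_real pi) (at w\<^sub>0)"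
proof -
  \<comment> \<open>\<open>R\<close> is \<open>S\<close> without the index 0 term of
    \<open>lam1 (u z)\<close>. Its remaining arguments both equal -q at \<open>w\<^sub>0\<close>,
    inside the unit disc, so it is analytic there.\<close>
  define R where "R z = 1 + 2 * lam1 (q * u z) - 2 * lam1 (u (- z))" for z
  have "R analytic_on {w\<^sub>0}" unfolding R_def
    by (intro analytic_intros lam1_comp_analytic u_analytic analytic_uminus_comp)
       (use q_power_small in \<open>auto simp: u_w0 u_minus_w0\<close>)
  hence R: "(R \<longlongrightarrow> R w\<^sub>0) (at w\<^sub>0)" by (intro isContD analytic_at_imp_isCont)
  have u: "((\<lambda>z. - 2 * u z) \<longlongrightarrow> - 2 * u w\<^sub>0) (at w\<^sub>0)"
    by (intro isContD analytic_at_imp_isCont analytic_intros u_analytic)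
  have "((\<lambda>z. (z - w\<^sub>0) * R z + (z - w\<^sub>0) / (1 + u z) * (- 2 * u z)) \<longlongrightarrow>
      (w\<^sub>0 - w\<^sub>0) * R w\<^sub>0 + \<i> / (2 * of_real pi) * (- 2 * u w\<^sub>0)) (at w\<^sub>0)"
    by (intro tendsto_add tendsto_mult R u_limit u tendsto_intros)
  also have "(\<lambda>z. (z - w\<^sub>0) * R z + (z - w\<^sub>0) / (1 + u z) * (- 2 * u z)) = (\<lambda>z. (z - w\<^sub>0) * S z)"
  proof
    fix z
    have e: "lam1 (u z) = u z / (1 + u z) - lam1 (q * u z)" using L1.lambert_series_step[of "u z"] by simp
    show "(z - w\<^sub>0) * R z + (z - w\<^sub>0) / (1 + u z) * (- 2 * u z) = (z - w\<^sub>0) * S z"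
      unfolding S_def R_def e by (simp add: algebra_simps add_divide_distrib diff_divide_distrib)
  qed
  finally show ?thesis by (simp add: u_w0)
qed

lemma T_limit: "((\<lambda>z. (z - w\<^sub>0) * T z) \<longlongrightarrow> \<i> / of_real pi) (at w\<^sub>0)"
proof -
  have small: "x * r ^ k \<notin> {\<i>, -\<i>}" if "norm x < 1" for x k
  proof
    assume "x * r ^ k \<in> {\<i>, -\<i>}"
    hence "norm (x * r ^ k) = 1" by auto
    moreover have "norm (x * r ^ k) \<le> norm x"
      using norm_r by (simp add: norm_mult norm_power mult_left_le power_le_one)
    ultimately show False using that by simp
  qed
  \<comment> \<open>The index 0 term of \<open>lam2 (X z)\<close> is again the only singular one;
    its limit contains a factor \<tau> that cancels the prefactor 2/\<tau>.\<close>
  define R where "R z = 2 * \<i> / \<tau> * (lam2 (r * X z) + lam2 (X (- z)))" for z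
  have "R analytic_on {w\<^sub>0}" unfolding R_def
    by (intro analytic_intros lam2_comp_analytic X_analytic analytic_uminus_comp small)
       (use norm_r in \<open>auto simp: X_w0 X_minus_w0 norm_mult\<close>)
  hence R: "(R \<longlongrightarrow> R w\<^sub>0) (at w\<^sub>0)" by (intro isContD analytic_at_imp_isCont)
  have X: "((\<lambda>z. 2 * \<i> / \<tau> * X z) \<longlongrightarrow> 2 * \<i> / \<tau> * X w\<^sub>0) (at w\<^sub>0)"
    by (intro isContD analytic_at_imp_isCont analytic_intros X_analytic) auto
  have "((\<lambda>z. (z - w\<^sub>0) * R z + (z - w\<^sub>0) / (1 + (X z)\<^sup>2) * (2 * \<i> / \<tau> * X z)) \<longlongrightarrow>
      (w\<^sub>0 - w\<^sub>0) * R w\<^sub>0 + \<tau> * \<i> / (2 * of_real pi) * (2 * \<i> / \<tau> * X w\<^sub>0)) (at w\<^sub>0)"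
    by (intro tendsto_add tendsto_mult R X_limit X tendsto_intros)
  also have "(\<lambda>z. (z - w\<^sub>0) * R z + (z - w\<^sub>0) / (1 + (X z)\<^sup>2) * (2 * \<i> / \<tau> * X z)) = (\<lambda>z. (z - w\<^sub>0) * T z)"
  proof
    fix z
    have e: "lam2 (X z) = X z / (1 + (X z)\<^sup>2) + lam2 (r * X z)" using L2.lambert_series_step[of "X z"] by simp
    show "(z - w\<^sub>0) * R z + (z - w\<^sub>0) / (1 + (X z)\<^sup>2) * (2 * \<i> / \<tau> * X z) = (z - w\<^sub>0) * T z"
      unfolding T_def R_def e by (simp add: algebra_simps add_divide_distrib diff_divide_distrib)
  qed
  finally show ?thesis by (simp add: X_w0)
qed

text \<open>The factor 1 + u is taken out of the denominator. At \<open>w\<^sub>0\<close> the rest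
  equals C E(1) E(q) / E(-q)^2 with E(1) = 2 E(q); after \<open>C\<close> cancels E(-q)^2, Euler's
  identity leaves 2. This is where the prefactor of the product formula gets its value.\<close>

lemma F_limit: "((\<lambda>z. (z - w\<^sub>0) * F z) \<longlongrightarrow> \<i> / of_real pi) (at w\<^sub>0)"
proof -
  define R where "R z = C * (qprod q (- u z) * qprod q (- u (- z))) / (qprod q (q * u z) * qprod q (u (- z)))" for z
  have nz: "qprod q (- q) \<noteq> 0" using qprod_nonzero[of q "- q"] norm_q by simp
  have "R analytic_on {w\<^sub>0}" unfolding R_def
    by (intro analytic_intros qprod_comp_analytic u_analytic analytic_uminus_comp)
       (use nz in \<open>auto simp: u_w0 u_minus_w0\<close>)
  hence R: "(R \<longlongrightarrow> R w\<^sub>0) (at w\<^sub>0)" by (intro isContD analytic_at_imp_isCont)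
  have "qprod q 1 = 2 * qprod q q" using qprod_step[OF norm_q, of 1] by simp
  hence "R w\<^sub>0 = 2 * (qprod q q * qprod (q\<^sup>2) (- q)) ^ 2"
    using nz by (simp add: R_def C_def u_w0 u_minus_w0 field_simps power2_eq_square)
  hence R_val: "R w\<^sub>0 = 2" by (simp add: qprod_euler norm_q)
  have "((\<lambda>z. (z - w\<^sub>0) / (1 + u z) * R z) \<longlongrightarrow> \<i> / (2 * of_real pi) * R w\<^sub>0) (at w\<^sub>0)"
    by (intro tendsto_mult R u_limit)
  also have "(\<lambda>z. (z - w\<^sub>0) / (1 + u z) * R z) = (\<lambda>z. (z - w\<^sub>0) * F z)"
    unfolding R_def F_def D_def by (subst (3) qprod_step[OF norm_q]) (simp add: mult_ac)
  finally show ?thesis by (simp add: R_val)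
qed

section \<open>Identification of \<open>F\<close> with \<open>S\<close> and \<open>T\<close>\<close>

lemma antiperiodic_eqI:
  assumes "\<And>z. z \<notin> P \<Longrightarrow> f analytic_on {z}" "\<And>z. z \<notin> P \<Longrightarrow> g analytic_on {z}"
    and "\<And>z. z \<notin> P \<Longrightarrow> f (z + 1) = f z" "\<And>z. z \<notin> P \<Longrightarrow> f (z + \<tau>) = - f z"
    and "\<And>z. z \<notin> P \<Longrightarrow> g (z + 1) = g z" "\<And>z. z \<notin> P \<Longrightarrow> g (z + \<tau>) = - g z"
    and f: "((\<lambda>z. (z - w\<^sub>0) * f z) \<longlongrightarrow> c) (at w\<^sub>0)" and g: "((\<lambda>z. (z - w\<^sub>0) * g z) \<longlongrightarrow> c) (at w\<^sub>0)"
    and z: "z \<notin> P"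
  shows "f z = g z"
proof -
  have "(\<lambda>z. f z - g z) analytic_on - P"
    using assms(1,2) by (subst analytic_on_analytic_at) (auto intro!: analytic_intros)
  hence hol: "(\<lambda>z. f z - g z) holomorphic_on - P" by (rule analytic_imp_holomorphic)
  have "((\<lambda>z. (z - w\<^sub>0) * (f z - g z)) \<longlongrightarrow> 0) (at w\<^sub>0)"
    using tendsto_diff[OF f g] by (simp add: algebra_simps)
  from antiperiodic_removable_imp_zero[of \<tau> "\<lambda>z. f z - g z" w\<^sub>0 z, folded P_def, OF Im_pos hol _ _ this z]
  show ?thesis using assms(3-6) by simp
qed

lemma F_eq_S: "z \<notin> P \<Longrightarrow> F z = S z"
  by (rule antiperiodic_eqI) (use F_analytic S_analytic F_shift S_shift F_limit S_limit in auto)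

lemma F_eq_T: "z \<notin> P \<Longrightarrow> F z = T z"
  by (rule antiperiodic_eqI) (use F_analytic T_analytic F_shift T_shift F_limit T_limit in auto)

text \<open>The zeros of numerator and denominator are disjoint, so every point of \<open>P\<close>
  is a genuine pole, and there the convention x / 0 = 0 supplies the value 0 that nice meromorphy
  demands.\<close>

lemma F_nicely_meromorphic: "F nicely_meromorphic_on UNIV"
proof (rule nicely_meromorphic_onI_open[of _ _ P])
  show "F analytic_on UNIV - P" by (subst analytic_on_analytic_at) (use F_analytic in auto)
  have Dhol: "D holomorphic_on UNIV" using D_analytic analytic_imp_holomorphic by blast
  have D0: "D 0 \<noteq> 0"
    unfolding D_eq_0_iff using P_coords(1)[of 0 0] by auto
  have near: "\<forall>\<^sub>F w in at z. D w \<noteq> 0" for z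
  proof (cases "D z = 0")
    case True
    obtain e where "e > 0" "\<And>w. w \<in> ball z e - {z} \<Longrightarrow> D w \<noteq> 0"
      using isolated_zeros[OF Dhol open_UNIV connected_UNIV _ True _ D0] by auto
    thus ?thesis unfolding eventually_at by (intro exI[of _ e]) (auto simp: dist_commute)
  next
    case False
    have "(D \<longlongrightarrow> D z) (at z)" by (intro isContD analytic_at_imp_isCont D_analytic)
    thus ?thesis using False tendsto_imp_eventually_ne by blast
  qed
  show "isolated_singularity_at F z" for z
  proof -
    obtain e where e: "e > 0" "\<And>w. w \<noteq> z \<Longrightarrow> dist w z < e \<Longrightarrow> D w \<noteq> 0"
      using near[of z] unfolding eventually_at by blast
    have "F analytic_on ball z e - {z}"
      by (subst analytic_on_analytic_at) (use e F_analytic D_eq_0_iff in \<open>auto simp: dist_commute\<close>)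
    thus ?thesis using e(1) unfolding isolated_singularity_at_def by blast
  qed
  fix z assume z: "z \<in> P"
  hence Dz: "D z = 0" using D_eq_0_iff by blast
  have num: "isCont (\<lambda>z. C * (qprod q (- u z) * qprod q (- u (- z)))) z"
    by (intro analytic_at_imp_isCont analytic_intros qprod_comp_analytic u_analytic analytic_uminus_comp)
  have "C \<noteq> 0"
    using qprod_euler[OF norm_q] qprod_nonzero[of q "- q"] norm_q by (auto simp: C_def)
  moreover have "qprod q (- u x) \<noteq> 0" if xP: "x \<in> P" for x
  proof
    assume "qprod q (- u x) = 0"
    then obtain k where k: "u x * q ^ k = 1" unfolding qprod_eq_0_iff[OF norm_q] by auto
    \<comment> \<open>Adding 1/2 turns the value 1 into -1, so the earlier description applies. Up
      to an integer, zeros of this factor have first coordinate 0, whereas on \<open>P\<close> it is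
      at least 1/2 in modulus.\<close>
    hence "exp (2 * \<i> * of_real pi * (x + \<tau> / 2 + of_nat k * \<tau> + 1 / 2)) = -1"
      unfolding u_mult by (simp add: distrib_left exp_add)
    then obtain j :: int where j: "x + \<tau> / 2 + of_nat k * \<tau> + 1 / 2 = 1 / 2 + of_int j"
      unfolding exp_2pi_i_eq_minus_1 by blast
    have "x = (x + \<tau> / 2 + of_nat k * \<tau> + 1 / 2) - 1 / 2 - \<tau> / 2 - of_nat k * \<tau>" by simp
    hence x: "x - of_int j = of_real 0 + of_real (- 1 / 2 - real k) * \<tau>"
      unfolding j by (simp add: algebra_simps)
    obtain m n where "x = w\<^sub>0 + of_int m + of_int n * \<tau>" using xP unfolding P_iff by blast
    hence "x - of_int j = w\<^sub>0 + of_int (m - j) + of_int n * \<tau>" by simp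
    hence "x - of_int j \<in> P" unfolding P_iff by blast
    thus False unfolding x using P_coords(1) by fastforce
  qed
  ultimately have "C * (qprod q (- u z) * qprod q (- u (- z))) \<noteq> 0"
    using z P_uminus[of z] by simp
  moreover have "filterlim D (at 0) (at z)"
    using near[of z] isContD[OF analytic_at_imp_isCont[OF D_analytic[of "{z}"]]] Dz
    by (simp add: filterlim_at)
  ultimately have "is_pole F z" unfolding F_def[abs_def] by (intro is_pole_divide num)
  thus "is_pole F z \<and> F z = 0" using Dz by (simp add: F_def)
qed auto

section \<open>From the Lambert series back to the trigonometric series\<close>

lemma lam1_power_series:
  assumes x: "norm x < 1"
  shows "(\<lambda>n. (-1) ^ n / (1 + q ^ Suc n) * x ^ Suc n) sums lam1 x"
proof -
  define c where "c n = (-1) ^ n / (1 + q ^ Suc n)" for n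
  \<comment> \<open>In g x + g (q * x) the coefficient c n is multiplied by 1 + q^(n+1), its own
    denominator, so a geometric series remains and \<open>g\<close> solves the equation of
    \<open>lam1\<close>.\<close>
  define g where "g x = x * (\<Sum>n. c n * x ^ n)" for x
  have lower: "1 - norm q \<le> norm (1 + q ^ Suc n)" for n
    using norm_triangle_ineq2[of 1 "- (q ^ Suc n)"] norm_power_Suc_le[OF norm_q, of n] by simp
  have nz: "1 + q ^ Suc n \<noteq> 0" for n
    using lower[of n] norm_q by auto
  have "norm (c n) \<le> 1 / (1 - norm q)" for n
  proof -
    have "norm (c n) = 1 / norm (1 + q ^ Suc n)"
      by (simp add: c_def norm_divide norm_power)
    also have "\<dots> \<le> 1 / (1 - norm q)"
      using lower[of n] norm_q by (intro frac_le) auto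
    finally show ?thesis .
  qed
  note ps = bounded_coeff_powser[of c, OF this]
  have "g x = lam1 x"
  proof (rule L1.lambert_series_unique[OF _ _ _ x])
    show "isCont g 0" unfolding g_def by (intro continuous_intros ps)
    show "g 0 = 0" by (simp add: g_def)
    fix x :: complex assume x: "norm x < 1"
    have qx: "norm (q * x) < 1"
      using x norm_q by (metis norm_mult mult_strict_mono' norm_ge_zero mult_1)
    have "(\<lambda>n. c n * x ^ n + q * (c n * (q * x) ^ n)) sums ((\<Sum>n. c n * x ^ n) + q * (\<Sum>n. c n * (q * x) ^ n))"
      by (intro sums_add sums_mult summable_sums ps x qx)
    moreover have "c n * x ^ n + q * (c n * (q * x) ^ n) = (- x) ^ n" for n
    proof -
      have "c n * x ^ n + q * (c n * (q * x) ^ n) = (c n * (1 + q ^ Suc n)) * x ^ n"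
        by (simp add: algebra_simps power_mult_distrib)
      also have "c n * (1 + q ^ Suc n) = (- 1) ^ n" using nz[of n] by (simp add: c_def)
      finally show ?thesis by (simp flip: power_mult_distrib)
    qed
    moreover have "(\<lambda>n. (- x) ^ n) sums (1 / (1 - (- x)))"
      using x by (intro geometric_sums) auto
    ultimately have "(\<Sum>n. c n * x ^ n) + q * (\<Sum>n. c n * (q * x) ^ n) = 1 / (1 + x)"
      using sums_unique2 by fastforce
    hence "x * ((\<Sum>n. c n * x ^ n) + q * (\<Sum>n. c n * (q * x) ^ n)) = x / (1 + x)"
      by simp
    thus "g x = x / (1 + x) + - 1 * g (q * x)"
      by (simp add: g_def algebra_simps)
  qed
  moreover have "(\<lambda>n. x * (c n * x ^ n)) sums g x"
    unfolding g_def by (intro sums_mult summable_sums ps x)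
  ultimately show ?thesis by (simp add: c_def mult_ac)
qed

lemma lam2_power_series:
  assumes x: "norm x < 1"
  shows "(\<lambda>n. (-1) ^ n / (1 - r ^ (2 * n + 1)) * x ^ (2 * n + 1)) sums lam2 x"
proof -
  define c where "c n = (-1) ^ n / (1 - r ^ (2 * n + 1))" for n
  \<comment> \<open>An odd power series is written as x times a series in x^2; g x - g (r * x)
    cancels the denominators 1 - r^(2n+1).\<close>
  define g where "g x = x * (\<Sum>n. c n * (x\<^sup>2) ^ n)" for x
  have lower: "1 - norm r \<le> norm (1 - r ^ (2 * n + 1))" for n
    using norm_triangle_ineq2[of 1 "r ^ (2 * n + 1)"] norm_power_Suc_le[OF norm_r, of "2 * n"] by simp
  have nz: "1 - r ^ (2 * n + 1) \<noteq> 0" for n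
    using lower[of n] norm_r by auto
  have "norm (c n) \<le> 1 / (1 - norm r)" for n
  proof -
    have "norm (c n) = 1 / norm (1 - r ^ (2 * n + 1))"
      by (simp add: c_def norm_divide norm_power)
    also have "\<dots> \<le> 1 / (1 - norm r)"
      using lower[of n] norm_r by (intro frac_le) auto
    finally show ?thesis .
  qed
  note ps = bounded_coeff_powser[of c, OF this]
  have sq: "norm (x\<^sup>2) < 1" if "norm x < 1" for x :: complex
    using that by (simp add: norm_power power_less_one_iff)
  have "g x = lam2 x"
  proof (rule L2.lambert_series_unique[OF _ _ _ x])
    have "isCont (\<lambda>x. \<Sum>n. c n * (x\<^sup>2) ^ n) 0"
      by (rule isCont_o2[where f = "\<lambda>x. x\<^sup>2" and g = "\<lambda>y. \<Sum>n. c n * y ^ n"]) (use ps(2) in \<open>auto intro!: continuous_intros\<close>)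
    thus "isCont g 0" unfolding g_def by (intro continuous_intros)
    show "g 0 = 0" by (simp add: g_def)
    fix x :: complex assume x: "norm x < 1"
    have rx: "norm (r * x) < 1"
      using x norm_r by (metis norm_mult mult_strict_mono' norm_ge_zero mult_1)
    have "(\<lambda>n. c n * (x\<^sup>2) ^ n - r * (c n * ((r * x)\<^sup>2) ^ n)) sums ((\<Sum>n. c n * (x\<^sup>2) ^ n) - r * (\<Sum>n. c n * ((r * x)\<^sup>2) ^ n))"
      by (intro sums_diff sums_mult summable_sums ps sq x rx)
    moreover have "c n * (x\<^sup>2) ^ n - r * (c n * ((r * x)\<^sup>2) ^ n) = (- (x\<^sup>2)) ^ n" for n
    proof -
      have "c n * (x\<^sup>2) ^ n - r * (c n * ((r * x)\<^sup>2) ^ n) = (c n * (1 - r ^ (2 * n + 1))) * (x\<^sup>2) ^ n"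
        by (simp add: algebra_simps power_mult_distrib flip: power_mult)
      also have "c n * (1 - r ^ (2 * n + 1)) = (- 1) ^ n" using nz[of n] by (simp add: c_def)
      finally show ?thesis by (simp only: power_mult_distrib[symmetric]) simp
    qed
    moreover have "(\<lambda>n. (- (x\<^sup>2)) ^ n) sums (1 / (1 - (- (x\<^sup>2))))"
      using sq[OF x] by (intro geometric_sums) auto
    ultimately have "(\<Sum>n. c n * (x\<^sup>2) ^ n) - r * (\<Sum>n. c n * ((r * x)\<^sup>2) ^ n) = 1 / (1 + x\<^sup>2)"
      using sums_unique2 by fastforce
    hence "x * ((\<Sum>n. c n * (x\<^sup>2) ^ n) - r * (\<Sum>n. c n * ((r * x)\<^sup>2) ^ n)) = x / (1 + x\<^sup>2)"
      by simp
    thus "g x = x / (1 + x\<^sup>2) + 1 * g (r * x)"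
      by (simp add: g_def algebra_simps)
  qed
  moreover have "(\<lambda>n. x * (c n * (x\<^sup>2) ^ n)) sums g x"
    unfolding g_def by (intro sums_mult summable_sums ps sq x)
  moreover have "x * (c n * (x\<^sup>2) ^ n) = (-1) ^ n / (1 - r ^ (2 * n + 1)) * x ^ (2 * n + 1)" for n
    by (simp add: c_def flip: power_mult)
  ultimately show ?thesis by simp
qed

lemma ND_strip1_eq:
  assumes "norm (u z) < 1" "norm (u (- z)) < 1"
  shows "ND_strip1 z \<tau> = S z"
proof -
  have sums: "(\<lambda>n. - ((-1) ^ n / (1 + q ^ Suc n) * u z ^ Suc n + (-1) ^ n / (1 + q ^ Suc n) * u (- z) ^ Suc n))
          sums (- (lam1 (u z) + lam1 (u (- z))))"
    by (intro sums_minus sums_add lam1_power_series assms)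
  have eq: "- ((-1) ^ n / (1 + q ^ Suc n) * u z ^ Suc n + (-1) ^ n / (1 + q ^ Suc n) * u (- z) ^ Suc n) =
       (-1) ^ Suc n * cos (2 * of_nat (Suc n) * of_real pi * z) / cos (of_nat (Suc n) * of_real pi * \<tau>)" for n
  proof -
    \<comment> \<open>Chosen so that a b, b / a and b^2 are the (n+1)-st powers of u z, u (- z) and
      \<open>q\<close>.\<close>
    define a b where "a = exp (\<i> * (2 * of_nat (Suc n) * of_real pi * z))" and "b = exp (\<i> * (of_nat (Suc n) * of_real pi * \<tau>))"
    have 1: "u z ^ Suc n = a * b" unfolding u_def a_def b_def exp_of_nat_mult[symmetric] exp_add[symmetric]
      by (rule arg_cong[of _ _ exp]) (simp add: algebra_simps)
    have 2: "u (- z) ^ Suc n = b / a" unfolding u_def a_def b_def exp_of_nat_mult[symmetric] exp_diff[symmetric]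
      by (rule arg_cong[of _ _ exp]) (simp add: algebra_simps)
    have 3: "q ^ Suc n = b\<^sup>2" unfolding q_def b_def exp_of_nat_mult[symmetric] exp_double[symmetric]
      by (rule arg_cong[of _ _ exp]) (simp add: algebra_simps)
    have "cos (2 * of_nat (Suc n) * of_real pi * z) / cos (of_nat (Suc n) * of_real pi * \<tau>) =
        ((a + inverse a) / 2) / ((b + inverse b) / 2)"
      unfolding cos_exp_eq exp_minus a_def b_def by simp
    also have "\<dots> = (a * b + b / a) / (1 + b\<^sup>2)"
      by (rule cos_quotient) (simp_all add: a_def b_def)
    finally have 4: "cos (2 * of_nat (Suc n) * of_real pi * z) / cos (of_nat (Suc n) * of_real pi * \<tau>) = (a * b + b / a) / (1 + b\<^sup>2)" .
    show ?thesis unfolding times_divide_eq_right[symmetric] 4 unfolding 1 2 3 distrib_left[symmetric] by simp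
  qed
  have "(\<Sum>n. (-1) ^ Suc n * cos (2 * of_nat (Suc n) * of_real pi * z) / cos (of_nat (Suc n) * of_real pi * \<tau>)) =
      - (lam1 (u z) + lam1 (u (- z)))"
    using sums_unique[OF sums] unfolding eq by (rule sym)
  thus ?thesis unfolding ND_strip1_def S_def by (simp only:) simp
qed

lemma ND_strip2_eq:
  assumes "norm (X z) < 1" "norm (X (- z)) < 1"
  shows "ND_strip2 z \<tau> = T z"
proof -
  have sums: "(\<lambda>n. \<i> * ((-1) ^ n / (1 - r ^ (2 * n + 1)) * X z ^ (2 * n + 1) + (-1) ^ n / (1 - r ^ (2 * n + 1)) * X (- z) ^ (2 * n + 1)))
          sums (\<i> * (lam2 (X z) + lam2 (X (- z))))"
    by (intro sums_mult sums_add lam2_power_series assms)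
  have eq: "\<i> * ((-1) ^ n / (1 - r ^ (2 * n + 1)) * X z ^ (2 * n + 1) + (-1) ^ n / (1 - r ^ (2 * n + 1)) * X (- z) ^ (2 * n + 1)) =
       (-1) ^ n * cos ((2 * of_nat n + 1) * of_real pi * z / \<tau>) / sin ((of_nat n + 1 / 2) * of_real pi / \<tau>)" for n
  proof -
    \<comment> \<open>The exponent of \<open>b\<close> is negative because \<open>r\<close> is built
      from -1/\<tau>; a b, b / a and b^2 are the (2n+1)-st powers of X z, X (- z) and
      \<open>r\<close>.\<close>
    define a b where "a = exp (\<i> * ((2 * of_nat n + 1) * of_real pi * z / \<tau>))" and "b = exp (- (\<i> * ((of_nat n + 1 / 2) * of_real pi / \<tau>)))"
    have 1: "X z ^ (2 * n + 1) = a * b" unfolding X_def a_def b_def exp_of_nat_mult[symmetric] exp_add[symmetric]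
      by (rule arg_cong[of _ _ exp]) (simp add: field_simps)
    have 2: "X (- z) ^ (2 * n + 1) = b / a" unfolding X_def a_def b_def exp_of_nat_mult[symmetric] exp_diff[symmetric]
      by (rule arg_cong[of _ _ exp]) (simp add: field_simps)
    have 3: "r ^ (2 * n + 1) = b\<^sup>2" unfolding r_def b_def exp_of_nat_mult[symmetric] exp_double[symmetric]
      by (rule arg_cong[of _ _ exp]) (simp add: field_simps)
    have "cos ((2 * of_nat n + 1) * of_real pi * z / \<tau>) / sin ((of_nat n + 1 / 2) * of_real pi / \<tau>) =
        ((a + inverse a) / 2) / (- \<i> * (inverse b - b) / 2)"
      unfolding cos_exp_eq sin_exp_eq exp_minus a_def b_def inverse_inverse_eq by simp
    also have "\<dots> = \<i> * (a * b + b / a) / (1 - b\<^sup>2)"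
      by (rule cos_quotient) (simp_all add: a_def b_def)
    finally have 4: "cos ((2 * of_nat n + 1) * of_real pi * z / \<tau>) / sin ((of_nat n + 1 / 2) * of_real pi / \<tau>) = \<i> * (a * b + b / a) / (1 - b\<^sup>2)" .
    show ?thesis unfolding times_divide_eq_right[symmetric, of "(-1) ^ n" "cos _"] 4 unfolding 1 2 3 distrib_left[symmetric] by simp
  qed
  have "(\<Sum>n. (-1) ^ n * cos ((2 * of_nat n + 1) * of_real pi * z / \<tau>) / sin ((of_nat n + 1 / 2) * of_real pi / \<tau>)) =
      \<i> * (lam2 (X z) + lam2 (X (- z)))"
    using sums_unique[OF sums] unfolding eq by (rule sym)
  thus ?thesis unfolding ND_strip2_def T_def by (simp only:) simp
qed

text \<open>The condition |u z| < 1 says y > -1/2, and |u (- z)| < 1 says y < 1/2: together they are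
  exactly the first strip.\<close>

lemma norm_u: "norm (u (of_real x + of_real y * \<tau>)) = exp (- (2 * y + 1) * pi * Im \<tau>)"
  by (simp add: u_def norm_exp_eq_Re) (simp add: algebra_simps)

text \<open>As Im (1/\<tau>) < 0, the conditions on X z and X (- z) say x < 1/2 and x >
  -1/2.\<close>

lemma norm_X: "norm (X (of_real x + of_real y * \<tau>)) = exp ((1 - 2 * x) * pi / 2 * Im (1 / \<tau>))"
proof -
  define s where "s = 1 / \<tau>"
  have *: "\<i> * of_real pi * (of_real x + of_real y * \<tau>) / \<tau> - \<i> * of_real pi / (2 * \<tau>) =
      of_real (pi * (x - 1 / 2)) * (\<i> * s) + of_real (pi * y) * \<i>"
    by (simp add: s_def field_simps)
  show ?thesis unfolding X_def norm_exp_eq_Re * s_def[symmetric] by (simp add: algebra_simps)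
qed

lemma is_ND_F: "is_ND \<tau> F"
  unfolding is_ND_def
proof (intro conjI allI impI)
  fix x y :: real
  define z where "z = of_real x + of_real y * \<tau>"
  have mz: "- z = of_real (- x) + of_real (- y) * \<tau>" by (simp add: z_def)
  {
    assume y: "\<bar>y\<bar> < 1 / 2"
    have "z \<notin> P" using P_coords(2)[of x y] y unfolding z_def by force
    moreover have "norm (u z) < 1" "norm (u (- z)) < 1"
      unfolding mz unfolding z_def norm_u using y Im_pos by (auto intro!: mult_neg_pos)
    ultimately show "F z = ND_strip1 z \<tau>" using F_eq_S ND_strip1_eq by simp
  next
    assume x: "\<bar>x\<bar> < 1 / 2"
    have "z \<notin> P" using P_coords(1)[of x y] x unfolding z_def by force
    moreover have "norm (X z) < 1" "norm (X (- z)) < 1"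
      unfolding mz unfolding z_def norm_X using x Im_inverse_tau by (auto simp del: Im_divide intro!: mult_pos_neg)
    ultimately show "F z = ND_strip2 z \<tau>" using F_eq_T ND_strip2_eq by simp
  }
qed (rule F_nicely_meromorphic)

section \<open>The definite description of \<open>ND\<close> is well defined\<close>

lemma is_ND_unique:
  assumes f: "is_ND \<tau> f" and g: "is_ND \<tau> g"
  shows "f = g"
proof
  fix z
  define U where "U = {z. \<bar>Im z\<bar> < Im \<tau> / 2}"
  have "open U" unfolding U_def by (intro open_Collect_less continuous_intros)
  have U: "f w = g w" if "w \<in> U" for w
  proof -
    define y x where "y = Im w / Im \<tau>" and "x = Re w - y * Re \<tau>"
    have w: "w = of_real x + of_real y * \<tau>"
      using Im_pos by (simp add: complex_eq_iff x_def y_def)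
    have "\<bar>y\<bar> < 1 / 2" using that Im_pos by (simp add: U_def y_def field_simps)
    thus ?thesis using f g unfolding is_ND_def w by simp
  qed
  define h where "h w = f w - g w" for w
  have nice: "f nicely_meromorphic_on UNIV" "g nicely_meromorphic_on UNIV"
    using f g by (simp_all add: is_ND_def)
  hence mero: "h meromorphic_on UNIV"
    unfolding h_def nicely_meromorphic_on_def by (auto intro!: meromorphic_intros)
  have hU: "remove_sings h w = 0" if "w \<in> U" for w
  proof (rule remove_sings_eqI)
    have "\<forall>\<^sub>F v in at w. h v = 0"
      using \<open>open U\<close> that U unfolding eventually_at_topological h_def by auto
    thus "h \<midarrow>w\<rightarrow> 0" by (rule tendsto_eventually)
  qed
  have "0 \<in> U" using Im_pos by (simp add: U_def)
  have "remove_sings h constant_on UNIV"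
    by (rule constant_on_extend_nicely_meromorphic_on[OF remove_sings_nicely_meromorphic[OF mero], of U])
       (use hU \<open>0 \<in> U\<close> \<open>open U\<close> in \<open>auto simp: constant_on_def\<close>)
  hence "remove_sings h w = 0" for w
    using hU[OF \<open>0 \<in> U\<close>] by (auto simp: constant_on_def)
  with eventually_remove_sings_eq[OF mero] have ev: "\<forall>\<^sub>F w in at z. f w = g w"
    by (auto simp: eventually_cosparse_open_eq h_def)
  \<comment> \<open>The identity theorem gives agreement only in punctured neighbourhoods. The value
    at the centre is then forced: 0 at a common pole, the common limit otherwise.\<close>
  have pole: "is_pole f z \<longleftrightarrow> is_pole g z"
    by (rule is_pole_cong[OF ev refl])
  have "is_pole f z \<and> f z = 0 \<or> f \<midarrow>z\<rightarrow> f z" "is_pole g z \<and> g z = 0 \<or> g \<midarrow>z\<rightarrow> g z"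
    using nice by (auto simp: nicely_meromorphic_on_def)
  moreover have "f z = g z" if "f \<midarrow>z\<rightarrow> f z" "g \<midarrow>z\<rightarrow> g z"
    using that tendsto_cong[OF ev] LIM_unique by blast
  moreover have "\<not> is_pole k z" if "k \<midarrow>z\<rightarrow> c" for k :: "complex \<Rightarrow> complex" and c
    using that unfolding is_pole_def by (meson at_neq_bot not_tendsto_and_filterlim_at_infinity)
  ultimately show "f z = g z" using pole by metis
qed

lemma ND_eq_F: "ND z \<tau> = F z"
proof -
  have "(THE f. is_ND \<tau> f) = F"
    by (intro the_equality is_ND_F is_ND_unique)
  thus ?thesis by (simp add: ND_def)
qed

end

theorem mainTheorem12:
  fixes \<tau> :: complex
  assumes "Im \<tau> > 0"
  defines "A \<equiv> (\<lambda>n. (1 - qpow \<tau> (2 * real n + 1)) ^ 2 * (1 - qpow \<tau> (real n + 1)) ^ 2)"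
  defines "B \<equiv> (\<lambda>z n.
      ((1 - exp (2 * \<i> * of_real pi * z) * qpow \<tau> (real n + 1 / 2)) *
       (1 - exp (- 2 * \<i> * of_real pi * z) * qpow \<tau> (real n + 1 / 2))) /
      ((1 + exp (2 * \<i> * of_real pi * z) * qpow \<tau> (real n + 1 / 2)) *
       (1 + exp (- 2 * \<i> * of_real pi * z) * qpow \<tau> (real n + 1 / 2))))"
  shows "is_ND \<tau> (\<lambda>z. ND z \<tau>) \<and>
         convergent_prod A \<and> (\<forall>z. convergent_prod (B z)) \<and>
         (\<forall>z. ND z \<tau> = (\<Prod>n. A n) * (\<Prod>n. B z n))"
proof -
  interpret half_plane_point \<tau> by unfold_locales fact
  have q2: "norm (q\<^sup>2) < 1"
    using norm_q by (simp add: norm_power power_less_one_iff)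
  have has_qprod: "(\<lambda>k. 1 + x * p ^ k) has_prod qprod p x" if "norm p < 1" for p x :: complex
    unfolding qprod_def by (intro convergent_prod_has_prod convergent_qprod that)
  have qpow1: "qpow \<tau> (2 * real n + 1) = q * (q\<^sup>2) ^ n" "qpow \<tau> (real n + 1) = q * q ^ n" for n
  proof -
    have *: "qpow \<tau> (real k) = q ^ k" for k
      unfolding qpow_def q_def exp_of_nat_mult[symmetric] by (simp add: mult_ac)
    show "qpow \<tau> (2 * real n + 1) = q * (q\<^sup>2) ^ n"
      using *[of "2 * n + 1"] by (simp add: power_mult add.commute)
    show "qpow \<tau> (real n + 1) = q * q ^ n"
      using *[of "n + 1"] by (simp add: add.commute)
  qed
  have qpow2: "exp (2 * \<i> * of_real pi * z) * qpow \<tau> (real n + 1 / 2) = u z * q ^ n" for z n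
    unfolding qpow_def q_def u_def exp_of_nat_mult[symmetric] exp_add[symmetric]
    by (rule arg_cong[of _ _ exp]) (simp add: algebra_simps)
  have qpow3: "exp (- 2 * \<i> * of_real pi * z) * qpow \<tau> (real n + 1 / 2) = u (- z) * q ^ n" for z n
    using qpow2[of "- z" n] by simp
  have "(\<lambda>n. (1 + - q * (q\<^sup>2) ^ n) ^ 2 * (1 + - q * q ^ n) ^ 2) has_prod C"
    unfolding C_def by (intro has_prod_mult has_prod_power has_qprod norm_q q2)
  hence A: "A has_prod C"
    unfolding A_def qpow1 by simp
  \<comment> \<open>This covers z in \<open>P\<close> too: a denominator factor vanishes, the
    quotient factor is 0 by x / 0 = 0, and so is the quotient by D z = 0.\<close>
  have B: "B z has_prod (qprod q (- u z) * qprod q (- u (- z)) / D z)" for z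
  proof -
    have "(\<lambda>n. (1 + - u z * q ^ n) * (1 + - u (- z) * q ^ n) / ((1 + u z * q ^ n) * (1 + u (- z) * q ^ n)))
        has_prod (qprod q (- u z) * qprod q (- u (- z)) / D z)"
      unfolding D_def by (intro has_prod_mult has_prod_divide has_qprod norm_q)
    thus ?thesis unfolding B_def qpow2 qpow3 by simp
  qed
  have "is_ND \<tau> (\<lambda>z. ND z \<tau>)"
    using is_ND_F by (simp add: ND_eq_F)
  moreover have "ND z \<tau> = prodinf A * prodinf (B z)" for z
    unfolding ND_eq_F F_def has_prod_unique[OF A, symmetric] has_prod_unique[OF B[of z], symmetric] by simp
  ultimately show ?thesis
    using A B unfolding has_prod_iff by blast
qed

end
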